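(* Consider the multistage stochastic linear program with stagewise independent, finitely supported data described in the context, and run the Quadratic Regularization Method with Stagewise Independence (described in the context) for $k=0,1,2,\dots$ with positive semidefinite matrices $Q_t\succeq 0$ and penalty sequence $\{\varrho^k\}$. Suppose that: 1. $\overline{V}_T^k(\cdot)\equiv V_T^*(\cdot)$ for all $k$; 2. dual basic optimal solutions are used in the backward pass; 3. every $\omega\in\Omega$ has strictly positive probability $\mathbb{P}(\omega)>0$; 4. $\varrho^k\ge 0$ for all $k$ and $\lim_{k\to\infty}\varrho^k=0$; 5. the feasible sets $\mathcal{X}_t(S_t)$ are bounded for each $t=0,\dots,T$. Then, with probability one, the method converges to an optimal policy of the multistage problem after a finite number of iterations; that is, almost surely there is a finite $k_0$ such that for all $k\ge k_0$ the value function approximations $\overline{V}^k_t$, $t=0,\dots,T$, are optimal in the sense defined in the context: for every $\omega\in\Omega$ and every $t=0,\dots,T$, $$\min_{x_t\in\mathcal{X}_t(S_t(\omega))}\big\{C(S_t(\omega),x_t)+\overline{V}^k_t(R^x_t)\big\}=\min_{x_t\in\mathcal{X}_t(S_t(\omega))}\big\{C(S_t(\omega),x_t)+V^*_t(R^x_t)\big\}.$$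
   Context: **Problem.** Let $T\ge 1$ be finite. The data at time $0$, $(A_0,B_0,b_0,c_0)$, are deterministic. For $t=1,\dots,T$ the data $W_t=(A_t,B_t,b_t,c_t)$ (matrices $A_t,B_t$, vectors $b_t,c_t$) are random, with finite set of realizations $\Omega_t$; elements are written $\omega_t\in\Omega_t$, and $A_t(\omega_t)$, etc. denote the corresponding data. A scenario is $\omega=(\omega_1,\dots,\omega_T)\in\Omega\subseteq\Omega_1\times\dots\times\Omega_T$, with probability $\mathbb{P}(\omega)$. The process is stagewise independent: $\mathbb{P}(\omega_{t+1}\mid\omega_1,\dots,\omega_t)=\mathbb{P}(\omega_{t+1})$. The problem is $$\min_{\substack{A_0x_0=b_0,\; x_0\ge0}}\langle c_0,x_0\rangle+\mathbb{E}_1\Big[\min_{\substack{B_0x_0+A_1x_1=b_1,\; x_1\ge0}}\langle c_1,x_1\rangle+\mathbb{E}_2\big[\cdots+\mathbb{E}_T\big[\min_{\substack{B_{T-1}x_{T-1}+A_Tx_T=b_T,\; x_T\ge0}}\langle c_T,x_T\rangle\big]\cdots\big]\Big].$$ **Notation.** The post-decision resource state is $R^x_t=B_tx_t$. The pre-decision state $S_t$ at time $t\ge1$ consists of the previous post-decision resource state $R^x_{t-1}$ and the time-$t$ data (the information $I_t(\omega_t)$); $S_0$ is the time-0 data. $C(S_t,x_t)=\langle c_t,x_t\rangle$. The feasible sets are $\mathcal{X}_0(S_0)=\{x_0\ge0:A_0x_0=b_0\}$ and, for $t\ge1$, $\mathcal{X}_t(S_t)=\mathcal{X}_t(R^x_{t-1},I_t(\omega_t))=\{x_t\ge0:R^x_{t-1}+A_t(\omega_t)x_t=b_t(\omega_t)\}$.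 Inside any minimization over $x_t$, $R^x_t$ stands for $B_tx_t$. **Standing assumption (relatively complete recourse).** The time-$0$ problem is feasible, and for every sequence of feasible decisions up to time $t<T$ and every $\omega_{t+1}\in\Omega_{t+1}$ the resulting set $\mathcal{X}_{t+1}(S_{t+1})$ is nonempty. **Optimal value functions.** $V^*_T\equiv0$ and, for $t=T,\dots,1$, $V^*_{t-1}(R^x_{t-1})=\sum_{\omega_t\in\Omega_t}\mathbb{P}(\omega_t)\min_{x_t\in\mathcal{X}_t(R^x_{t-1},I_t(\omega_t))}\{C(S_t(\omega_t),x_t)+V^*_t(R^x_t)\}$. **The method.** Fix $Q_t\succeq0$, $t=0,\dots,T$, and $\{\varrho^k\}$. Set $\overline{V}^k_T:=V^*_T$ for all $k$, and $\overline{V}^{-1}_t:=-\infty$ for $t<T$. For $k=0,1,2,\dots$: *Forward pass.* Sample $\omega\in\Omega$ according to $\mathbb{P}$, independently of all previous iterations. For $t=0,\dots,T$, with $S_t(\omega)$ determined by $R^{x,k}_{t-1}$ (for $t\ge 1$) and the data $\omega_t$, select $x^k_t$ as follows. If $k=0$: $x_t^k\in\arg\min_{x_t\in\mathcal{X}_t(S_t(\omega))}C(S_t(\omega),x_t)$. If $k\ge1$ and $t<T$: $$x^k_t\in\arg\min_{x_t\in\mathcal{X}_t(S_t(\omega))}\Big\{C(S_t(\omega),x_t)+\overline{V}^{k-1}_t(R^x_t)+\tfrac{\varrho^k}{2}\big\langle R^x_t-\overline{R}^{x,k-1}_t,\,Q_t(R^x_t-\overline{R}^{x,k-1}_t)\big\rangle\Big\}.$$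 If $k\ge1$ and $t=T$: $x^k_T\in\arg\min_{x_T\in\mathcal{X}_T(S_T(\omega))}\{C(S_T(\omega),x_T)+\overline{V}^{k-1}_T(R^x_T)\}$. Then set $R^{x,k}_t=B_tx^k_t$ (with the realized $B_t$). The selected minimizer is a function of the outcome of the previous iterations and of $\omega_1,\dots,\omega_t$ only. *Backward pass.* For $t=T,\dots,1$: for $\omega_t\in\Omega_t$ let $\underline{V}^k_t(R^x_{t-1},\omega_t)=\min_{x_t\in\mathcal{X}_t(R^x_{t-1},I_t(\omega_t))}\{C(S_t(\omega_t),x_t)+\overline{V}^k_t(R^x_t)\}$ and choose a subgradient $\underline{\beta}^k_t(\omega_t)\in\partial_{R^x_{t-1}}\underline{V}^k_t(R^{x,k}_{t-1},\omega_t)$. Set $\alpha^k_{t-1}=\sum_{\omega_t}\mathbb{P}(\omega_t)\underline{V}^k_t(R^{x,k}_{t-1},\omega_t)$, $\beta^k_{t-1}=\sum_{\omega_t}\mathbb{P}(\omega_t)\underline{\beta}^k_t(\omega_t)$, $h^k_{t-1}(R)=\alpha^k_{t-1}+\langle\beta^k_{t-1},R-R^{x,k}_{t-1}\rangle$, and $\overline{V}^k_{t-1}(R)=\max\{\overline{V}^{k-1}_{t-1}(R),h^k_{t-1}(R)\}$. *Incumbents.* Set $\overline{R}^{x,k}_t=R^{x,k}_t$ for $t=0,\dots,T-1$. **Dual basic solutions.** The problem defining $\underline{V}^k_t(R^{x,k}_{t-1},\omega_t)$ is a linear program: minimize $\langle c_t,x_t\rangle+\theta$ subject to $A_tx_t=b_t-R^{x,k}_{t-1}$,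 $x_t\ge0$, and $\theta\ge h^j_t(B_tx_t)$ for $j\le k$ (for $t=T$, no $\theta$ and no cuts). "Dual basic optimal solutions are used" means that each $\underline{\beta}^k_t(\omega_t)$ equals $-\pi$, where $\pi$ is the vector of multipliers of the equality constraints in a basic optimal solution of the dual of this linear program. **Optimality of approximations.** The approximations $\overline{V}^k_t$, $t=0,\dots,T$, are optimal if for every $\omega\in\Omega$ and $t=0,\dots,T$ the equality displayed in the claim holds, where $S_t(\omega)$ is the state reached at time $t$ along $\omega$ by the forward-pass decisions of the method computed with the approximations $\overline{V}^k$ (i.e. the states that the forward pass of iteration $k+1$ generates if $\omega$ is the sampled scenario). *)

theory Defs
  imports "HOL-Probability.Probability" "Jordan_Normal_Form.VS_Connect"
begin

type_synonym rvec = "real Matrix.vec"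
type_synonym rmat = "real Matrix.mat"

definition bounded_vecs :: "rvec set \<Rightarrow> bool" where
  "bounded_vecs X \<longleftrightarrow> (\<exists>r. \<forall>x\<in>X. sqrt (scalar_prod x x) \<le> r)"

definition psd_mat :: "nat \<Rightarrow> rmat \<Rightarrow> bool" where
  "psd_mat d Q \<longleftrightarrow> Q \<in> carrier_mat d d \<and> transpose_mat Q = Q \<and>
     (\<forall>v\<in>carrier_vec d. 0 \<le> scalar_prod v (Q *\<^sub>v v))"

definition subdifferential :: "nat \<Rightarrow> (rvec \<Rightarrow> ereal) \<Rightarrow> rvec \<Rightarrow> rvec set" where
  "subdifferential d f R = {g \<in> carrier_vec d. \<bar>f R\<bar> \<noteq> \<infinity> \<and>
     (\<forall>R'\<in>carrier_vec d. f R + ereal (scalar_prod g (R' - R)) \<le> f R')}"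


section \<open>Linear programs and basic solutions of their duals\<close>

text \<open>
  The linear program: minimize \<open>lp_obj \<bullet> z\<close> subject to \<open>lp_E z = lp_e\<close>, \<open>lp_G z \<ge> lp_g\<close> and
  \<open>z\<^sub>i \<ge> 0\<close> for \<open>i \<in> lp_sign\<close>; the other variables are free.
\<close>

record lin_prog =
  lp_obj :: rvec
  lp_E :: rmat
  lp_e :: rvec
  lp_G :: rmat
  lp_g :: rvec
  lp_sign :: "nat set"

text \<open>
  A polyhedron is given by equations \<open>a \<bullet> y = r\<close>, \<open>(a, r) \<in> Eqs\<close>, and inequalities
  \<open>a \<bullet> y \<le> r\<close>, \<open>(a, r) \<in> Ineqs\<close>.  A basic solution satisfies all equations, and among the
  constraints active at it there are as many linearly independent ones as there are variables.
\<close>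

definition poly_feasible :: "nat \<Rightarrow> (rvec \<times> real) set \<Rightarrow> (rvec \<times> real) set \<Rightarrow> rvec \<Rightarrow> bool" where
  "poly_feasible d Eqs Ineqs y \<longleftrightarrow> y \<in> carrier_vec d \<and>
     (\<forall>(a, r)\<in>Eqs. scalar_prod a y = r) \<and> (\<forall>(a, r)\<in>Ineqs. scalar_prod a y \<le> r)"

definition basic_solution :: "nat \<Rightarrow> (rvec \<times> real) set \<Rightarrow> (rvec \<times> real) set \<Rightarrow> rvec \<Rightarrow> bool" where
  "basic_solution d Eqs Ineqs y \<longleftrightarrow> y \<in> carrier_vec d \<and>
     (\<forall>(a, r)\<in>Eqs. scalar_prod a y = r) \<and>
     (\<exists>S. S \<subseteq> {a. \<exists>r. (a, r) \<in> Eqs \<union> Ineqs \<and> scalar_prod a y = r} \<and> finite S \<and> card S = d \<and>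
        \<not> LinearCombinations.module.lin_dep class_ring (module_vec TYPE(real) d) S)"

text \<open>
  The dual: maximize \<open>lp_e \<bullet> \<pi> + lp_g \<bullet> \<mu>\<close> over \<open>y = (\<pi>, \<mu>)\<close> with \<open>\<mu> \<ge> 0\<close>, where
  \<open>lp_E\<^sup>T \<pi> + lp_G\<^sup>T \<mu>\<close> is at most \<open>lp_obj\<close> in the components of sign-constrained variables and
  equal to it in the components of free variables.
\<close>

definition dual_dim :: "lin_prog \<Rightarrow> nat" where
  "dual_dim lp = dim_row (lp_E lp) + dim_row (lp_G lp)"

definition dual_row :: "lin_prog \<Rightarrow> nat \<Rightarrow> rvec \<times> real" where
  "dual_row lp i = (Matrix.col (lp_E lp) i @\<^sub>v Matrix.col (lp_G lp) i, vec_index (lp_obj lp) i)"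

definition dual_eqs :: "lin_prog \<Rightarrow> (rvec \<times> real) set" where
  "dual_eqs lp = {dual_row lp i | i. i < dim_vec (lp_obj lp) \<and> i \<notin> lp_sign lp}"

definition dual_ineqs :: "lin_prog \<Rightarrow> (rvec \<times> real) set" where
  "dual_ineqs lp = {dual_row lp i | i. i < dim_vec (lp_obj lp) \<and> i \<in> lp_sign lp} \<union>
     {(- unit_vec (dual_dim lp) (dim_row (lp_E lp) + j), 0) | j. j < dim_row (lp_G lp)}"

definition dual_obj :: "lin_prog \<Rightarrow> rvec \<Rightarrow> real" where
  "dual_obj lp y = scalar_prod (lp_e lp @\<^sub>v lp_g lp) y"

definition dual_basic_optimal :: "lin_prog \<Rightarrow> rvec \<Rightarrow> bool" where
  "dual_basic_optimal lp y \<longleftrightarrow>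
     basic_solution (dual_dim lp) (dual_eqs lp) (dual_ineqs lp) y \<and>
     poly_feasible (dual_dim lp) (dual_eqs lp) (dual_ineqs lp) y \<and>
     (\<forall>y'. poly_feasible (dual_dim lp) (dual_eqs lp) (dual_ineqs lp) y' \<longrightarrow>
        dual_obj lp y' \<le> dual_obj lp y)"


section \<open>The multistage stochastic linear program\<close>

record stage_data =
  Amat :: rmat
  Bmat :: rmat
  bvec :: rvec
  cvec :: rvec

text \<open>
  \<open>xdim t\<close> is the dimension of \<open>x\<^sub>t\<close>, and \<open>rdim t\<close> the number of rows of \<open>A\<^sub>t\<close>, that is, the
  dimension of \<open>b\<^sub>t\<close> and of \<open>R\<^sup>x\<close> at time \<open>t - 1\<close>.  \<open>data0\<close> is the deterministic data at time \<open>0\<close>,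
  \<open>data t a\<close> the data of realization \<open>a\<close> at time \<open>t \<ge> 1\<close>.  A scenario is a function \<open>v\<close> on
  \<open>{1..horizon}\<close> with \<open>v t = \<omega>\<^sub>t\<close>.
\<close>

record 'w mslp =
  horizon :: nat
  xdim :: "nat \<Rightarrow> nat"
  rdim :: "nat \<Rightarrow> nat"
  data0 :: stage_data
  data :: "nat \<Rightarrow> 'w \<Rightarrow> stage_data"
  outcomes :: "nat \<Rightarrow> 'w set"
  scenarios :: "(nat \<Rightarrow> 'w) set"
  law :: "(nat \<Rightarrow> 'w) pmf"

definition wf_stage :: "'w mslp \<Rightarrow> nat \<Rightarrow> stage_data \<Rightarrow> bool" where
  "wf_stage pr t d \<longleftrightarrow>
     Amat d \<in> carrier_mat (rdim pr t) (xdim pr t) \<and>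
     Bmat d \<in> carrier_mat (rdim pr (Suc t)) (xdim pr t) \<and>
     bvec d \<in> carrier_vec (rdim pr t) \<and>
     cvec d \<in> carrier_vec (xdim pr t)"

definition wf_mslp :: "'w mslp \<Rightarrow> bool" where
  "wf_mslp pr \<longleftrightarrow>
     1 \<le> horizon pr \<and>
     wf_stage pr 0 (data0 pr) \<and>
     (\<forall>t\<in>{1..horizon pr}. finite (outcomes pr t) \<and> (\<forall>a\<in>outcomes pr t. wf_stage pr t (data pr t a))) \<and>
     scenarios pr \<subseteq> Pi\<^sub>E {1..horizon pr} (outcomes pr) \<and>
     set_pmf (law pr) \<subseteq> scenarios pr"

definition stage_prob :: "'w mslp \<Rightarrow> nat \<Rightarrow> 'w \<Rightarrow> real" where
  "stage_prob pr t a = measure_pmf.prob (law pr) {v. v t = a}"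

definition stagewise_independent :: "'w mslp \<Rightarrow> bool" where
  "stagewise_independent pr \<longleftrightarrow>
     (\<forall>t<horizon pr. \<forall>v\<in>set_pmf (law pr). \<forall>a\<in>outcomes pr (Suc t).
        cond_prob (measure_pmf (law pr)) (\<lambda>w. w (Suc t) = a)
          (\<lambda>w. restrict w {1..t} = restrict v {1..t}) = stage_prob pr (Suc t) a)"

definition data_along :: "'w mslp \<Rightarrow> (nat \<Rightarrow> 'w) \<Rightarrow> nat \<Rightarrow> stage_data" where
  "data_along pr v t = (if t = 0 then data0 pr else data pr t (v t))"

text \<open>\<open>Init d\<close> is \<open>S\<^sub>0\<close>; \<open>Pre R d\<close> is a state at a time \<open>t \<ge> 1\<close> with previous post-decision
  resource state \<open>R\<close> and time-\<open>t\<close> data \<open>d\<close>.\<close>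

datatype pre_state = Init (info: stage_data) | Pre rvec (info: stage_data)

fun feasible :: "nat \<Rightarrow> pre_state \<Rightarrow> rvec set" where
  "feasible d (Init D) = {x \<in> carrier_vec d. 0\<^sub>v d \<le> x \<and> Amat D *\<^sub>v x = bvec D}"
| "feasible d (Pre R D) = {x \<in> carrier_vec d. 0\<^sub>v d \<le> x \<and> R + Amat D *\<^sub>v x = bvec D}"

definition cost :: "pre_state \<Rightarrow> rvec \<Rightarrow> real" where
  "cost S x = scalar_prod (cvec (info S)) x"

definition post :: "pre_state \<Rightarrow> rvec \<Rightarrow> rvec" where
  "post S x = Bmat (info S) *\<^sub>v x"

text \<open>The state at time \<open>t\<close> along \<open>v\<close> when the decisions \<open>y 0, \<dots>, y (t - 1)\<close> have been taken.\<close>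

definition state_along :: "'w mslp \<Rightarrow> (nat \<Rightarrow> rvec) \<Rightarrow> (nat \<Rightarrow> 'w) \<Rightarrow> nat \<Rightarrow> pre_state" where
  "state_along pr y v t =
     (if t = 0 then Init (data0 pr)
      else Pre (Bmat (data_along pr v (t - 1)) *\<^sub>v y (t - 1)) (data pr t (v t)))"

definition feasible_upto :: "'w mslp \<Rightarrow> (nat \<Rightarrow> 'w) \<Rightarrow> (nat \<Rightarrow> rvec) \<Rightarrow> nat \<Rightarrow> bool" where
  "feasible_upto pr v y t \<longleftrightarrow> (\<forall>s\<le>t. y s \<in> feasible (xdim pr s) (state_along pr y v s))"

definition relatively_complete_recourse :: "'w mslp \<Rightarrow> bool" where
  "relatively_complete_recourse pr \<longleftrightarrow>
     feasible (xdim pr 0) (Init (data0 pr)) \<noteq> {} \<and>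
     (\<forall>v\<in>scenarios pr. \<forall>y. \<forall>t<horizon pr. feasible_upto pr v y t \<longrightarrow>
        (\<forall>a\<in>outcomes pr (Suc t).
           feasible (xdim pr (Suc t)) (state_along pr y (v(Suc t := a)) (Suc t)) \<noteq> {}))"

definition bounded_feasible_sets :: "'w mslp \<Rightarrow> bool" where
  "bounded_feasible_sets pr \<longleftrightarrow>
     bounded_vecs (feasible (xdim pr 0) (Init (data0 pr))) \<and>
     (\<forall>v\<in>scenarios pr. \<forall>y. \<forall>t<horizon pr. feasible_upto pr v y t \<longrightarrow>
        (\<forall>a\<in>outcomes pr (Suc t).
           bounded_vecs (feasible (xdim pr (Suc t)) (state_along pr y (v(Suc t := a)) (Suc t)))))"

text \<open>The minimum of \<open>C(S, x) + V(R\<^sup>x)\<close> over the feasible decisions in state \<open>S\<close> at time \<open>t\<close>,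
  and its expectation over the time-\<open>t\<close> data as a function of the previous post-decision state.\<close>

definition stage_value :: "'w mslp \<Rightarrow> nat \<Rightarrow> (rvec \<Rightarrow> ereal) \<Rightarrow> pre_state \<Rightarrow> ereal" where
  "stage_value pr t V S = (INF x\<in>feasible (xdim pr t) S. ereal (cost S x) + V (post S x))"

definition exp_value :: "'w mslp \<Rightarrow> nat \<Rightarrow> (rvec \<Rightarrow> ereal) \<Rightarrow> rvec \<Rightarrow> ereal" where
  "exp_value pr t V R =
     (\<Sum>a\<in>outcomes pr t. ereal (stage_prob pr t a) * stage_value pr t V (Pre R (data pr t a)))"

function Vstar :: "'w mslp \<Rightarrow> nat \<Rightarrow> rvec \<Rightarrow> ereal" where
  "Vstar pr t = (if t < horizon pr then exp_value pr (Suc t) (Vstar pr (Suc t)) else (\<lambda>_. 0))"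
  by pat_completeness auto
termination by (relation "Wellfounded.measure (\<lambda>(pr, t). horizon pr - t)") auto

declare Vstar.simps [simp del]


section \<open>The quadratic regularization method\<close>

text \<open>
  The outcome of one iteration: the sampled scenario, the decisions \<open>dec t = x\<^sub>t\<^sup>k\<close> of the forward
  pass and the subgradients \<open>subg t a\<close> chosen for realization \<open>a\<close> at time \<open>t\<close> in the backward pass.
  Histories list the outcomes with the most recent iteration first.  Hence for a history \<open>h\<close> of
  length \<open>k\<close>, \<open>Vbar pr h\<close> below is the approximation with upper index \<open>k - 1\<close>, and \<open>h = []\<close>
  gives the initial one with upper index \<open>- 1\<close>.
\<close>

record 'w iteration =
  scen :: "nat \<Rightarrow> 'w"
  dec :: "nat \<Rightarrow> rvec"
  subg :: "nat \<Rightarrow> 'w \<Rightarrow> rvec"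

definition trial_point :: "'w mslp \<Rightarrow> 'w iteration \<Rightarrow> nat \<Rightarrow> rvec" where
  "trial_point pr it t = Bmat (data_along pr (scen it) t) *\<^sub>v dec it t"

text \<open>The slope and the value at the trial point of the new cut at time \<open>t\<close>; \<open>V\<close> is the updated
  approximation at time \<open>t + 1\<close>.  The conversion to the reals is lossless when the chosen
  subgradients exist, since then all the stage values entering the sum are finite.\<close>

definition cut_slope :: "'w mslp \<Rightarrow> 'w iteration \<Rightarrow> nat \<Rightarrow> rvec" where
  "cut_slope pr it t = Matrix.vec (rdim pr (Suc t))
     (\<lambda>i. \<Sum>a\<in>outcomes pr (Suc t). stage_prob pr (Suc t) a * vec_index (subg it (Suc t) a) i)"

definition cut_height :: "'w mslp \<Rightarrow> 'w iteration \<Rightarrow> nat \<Rightarrow> (rvec \<Rightarrow> ereal) \<Rightarrow> real" where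
  "cut_height pr it t V = real_of_ereal (exp_value pr (Suc t) V (trial_point pr it t))"

function backward :: "'w mslp \<Rightarrow> 'w iteration \<Rightarrow> (nat \<Rightarrow> rvec \<Rightarrow> ereal) \<Rightarrow> nat \<Rightarrow> rvec \<Rightarrow> ereal" where
  "backward pr it V t =
     (if t < horizon pr then
        (\<lambda>R. max (V t R)
           (ereal (cut_height pr it t (backward pr it V (Suc t)) +
              scalar_prod (cut_slope pr it t) (R - trial_point pr it t))))
      else Vstar pr (horizon pr))"
  by pat_completeness auto
termination by (relation "Wellfounded.measure (\<lambda>(pr, it, V, t). horizon pr - t)") auto

declare backward.simps [simp del]

primrec Vbar :: "'w mslp \<Rightarrow> 'w iteration list \<Rightarrow> nat \<Rightarrow> rvec \<Rightarrow> ereal" where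
  "Vbar pr [] = (\<lambda>t. if t < horizon pr then (\<lambda>_. - \<infinity>) else Vstar pr (horizon pr))"
| "Vbar pr (it # h) = backward pr it (Vbar pr h)"

text \<open>The cuts \<open>h\<^sub>t\<^sup>j\<close> generated so far at time \<open>t\<close>, as triples of the value \<open>\<alpha>\<^sub>t\<^sup>j\<close>, the slope
  \<open>\<beta>\<^sub>t\<^sup>j\<close> and the trial point.\<close>

primrec cuts :: "'w mslp \<Rightarrow> 'w iteration list \<Rightarrow> nat \<Rightarrow> (real \<times> rvec \<times> rvec) list" where
  "cuts pr [] t = []"
| "cuts pr (it # h) t =
     (cut_height pr it t (Vbar pr (it # h) (Suc t)), cut_slope pr it t, trial_point pr it t)
     # cuts pr h t"

text \<open>
  The linear program of the time-\<open>t\<close> subproblem for realization \<open>a\<close>.  For \<open>t < horizon\<close> its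
  variables are \<open>(x\<^sub>t, \<theta>)\<close>, and a cut \<open>(\<alpha>, \<beta>, R')\<close> contributes
  \<open>\<theta> - \<beta> \<bullet> B\<^sub>t x\<^sub>t \<ge> \<alpha> - \<beta> \<bullet> R'\<close>.
\<close>

definition stage_lp :: "'w mslp \<Rightarrow> 'w iteration list \<Rightarrow> nat \<Rightarrow> rvec \<Rightarrow> 'w \<Rightarrow> lin_prog" where
  "stage_lp pr h t R a =
     (let D = data pr t a; n = xdim pr t; cs = cuts pr h t in
      if t < horizon pr then
        \<lparr> lp_obj = cvec D @\<^sub>v Matrix.vec 1 (\<lambda>_. 1),
          lp_E = Matrix.mat (rdim pr t) (n + 1) (\<lambda>(i, j). if j < n then Amat D $$ (i, j) else 0),
          lp_e = bvec D - R,
          lp_G = Matrix.mat (length cs) (n + 1)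
            (\<lambda>(i, j). case cs ! i of (\<alpha>, \<beta>, R') \<Rightarrow>
               if j < n then - scalar_prod \<beta> (Matrix.col (Bmat D) j) else 1),
          lp_g = Matrix.vec (length cs) (\<lambda>i. case cs ! i of (\<alpha>, \<beta>, R') \<Rightarrow> \<alpha> - scalar_prod \<beta> R'),
          lp_sign = {..<n} \<rparr>
      else
        \<lparr> lp_obj = cvec D,
          lp_E = Amat D,
          lp_e = bvec D - R,
          lp_G = 0\<^sub>m 0 n,
          lp_g = 0\<^sub>v 0,
          lp_sign = {..<n} \<rparr>)"

definition forward_obj ::
  "'w mslp \<Rightarrow> (nat \<Rightarrow> rmat) \<Rightarrow> (nat \<Rightarrow> real) \<Rightarrow> 'w iteration list \<Rightarrow> nat \<Rightarrow> pre_state \<Rightarrow> rvec \<Rightarrow> ereal"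
where
  "forward_obj pr Q \<rho> h t S x =
     (case h of
        [] \<Rightarrow> ereal (cost S x)
      | it # _ \<Rightarrow>
          if t < horizon pr then
            ereal (cost S x) + Vbar pr h t (post S x) +
            ereal (\<rho> (length h) / 2 *
              scalar_prod (post S x - trial_point pr it t)
                (Q t *\<^sub>v (post S x - trial_point pr it t)))
          else ereal (cost S x) + Vbar pr h t (post S x))"

text \<open>
  A selection rule \<open>sel\<close> maps a history, a time \<open>t\<close> and \<open>(\<omega>\<^sub>1, \<dots>, \<omega>\<^sub>t)\<close> to a decision.
\<close>

type_synonym 'w rule = "'w iteration list \<Rightarrow> nat \<Rightarrow> (nat \<Rightarrow> 'w) \<Rightarrow> rvec"

definition forward_dec :: "'w rule \<Rightarrow> 'w iteration list \<Rightarrow> (nat \<Rightarrow> 'w) \<Rightarrow> nat \<Rightarrow> rvec" where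
  "forward_dec sel h v t = sel h t (restrict v {1..t})"

definition forward_state :: "'w mslp \<Rightarrow> 'w rule \<Rightarrow> 'w iteration list \<Rightarrow> (nat \<Rightarrow> 'w) \<Rightarrow> nat \<Rightarrow> pre_state"
where
  "forward_state pr sel h v = state_along pr (forward_dec sel h v) v"

text \<open>The rule is required to select minimizers along every scenario, sampled or not.\<close>

definition forward_ok ::
  "'w mslp \<Rightarrow> (nat \<Rightarrow> rmat) \<Rightarrow> (nat \<Rightarrow> real) \<Rightarrow> 'w rule \<Rightarrow> 'w iteration list \<Rightarrow> 'w iteration \<Rightarrow> bool"
where
  "forward_ok pr Q \<rho> sel h it \<longleftrightarrow>
     (\<forall>v\<in>scenarios pr. \<forall>t\<le>horizon pr.
        is_arg_min (forward_obj pr Q \<rho> h t (forward_state pr sel h v t))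
          (\<lambda>x. x \<in> feasible (xdim pr t) (forward_state pr sel h v t))
          (forward_dec sel h v t)) \<and>
     (\<forall>t\<le>horizon pr. dec it t = forward_dec sel h (scen it) t)"

definition backward_ok :: "'w mslp \<Rightarrow> 'w iteration list \<Rightarrow> 'w iteration \<Rightarrow> bool" where
  "backward_ok pr h it \<longleftrightarrow>
     (\<forall>t\<in>{1..horizon pr}. \<forall>a\<in>outcomes pr t.
        subg it t a \<in> subdifferential (rdim pr t)
          (\<lambda>R. stage_value pr t (Vbar pr (it # h) t) (Pre R (data pr t a)))
          (trial_point pr it (t - 1)))"

definition dual_basic_used :: "'w mslp \<Rightarrow> 'w iteration list \<Rightarrow> 'w iteration \<Rightarrow> bool" where
  "dual_basic_used pr h it \<longleftrightarrow>
     (\<forall>t\<in>{1..horizon pr}. \<forall>a\<in>outcomes pr t.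
        \<exists>y. dual_basic_optimal (stage_lp pr (it # h) t (trial_point pr it (t - 1)) a) y \<and>
            subg it t a = - vec_first y (rdim pr t))"

text \<open>A run of the method is a sequence of random iteration outcomes.\<close>

primrec history :: "(nat \<Rightarrow> 'm \<Rightarrow> 'w iteration) \<Rightarrow> nat \<Rightarrow> 'm \<Rightarrow> 'w iteration list" where
  "history It 0 m = []"
| "history It (Suc k) m = It k m # history It k m"

text \<open>
  Each scenario is drawn from \<open>law\<close>, independently of all previous iterations.  Outcomes of
  iterations are discrete random elements: when dual basic solutions are used there are, given
  the past and the sampled scenario, only finitely many possible subgradients.
\<close>

definition qrm_run ::
  "'w mslp \<Rightarrow> (nat \<Rightarrow> rmat) \<Rightarrow> (nat \<Rightarrow> real) \<Rightarrow> 'w rule \<Rightarrow> 'm measure \<Rightarrow> (nat \<Rightarrow> 'm \<Rightarrow> 'w iteration) \<Rightarrow> bool"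
where
  "qrm_run pr Q \<rho> sel M It \<longleftrightarrow>
     (\<forall>k. history It k \<in> measurable M (count_space UNIV) \<and>
          (\<lambda>m. scen (It k m)) \<in> measurable M (count_space UNIV) \<and>
          distr M (count_space UNIV) (\<lambda>m. scen (It k m)) = measure_pmf (law pr) \<and>
          prob_space.indep_set M
            {history It k -` X \<inter> space M | X. X \<in> UNIV}
            {(\<lambda>m. scen (It k m)) -` Y \<inter> space M | Y. Y \<in> UNIV}) \<and>
     (AE m in M. \<forall>k. forward_ok pr Q \<rho> sel (history It k m) (It k m) \<and>
        backward_ok pr (history It k m) (It k m))"

end

theory Submission
  imports Defs
begin

text \<open>
  The multipliers of a basic dual solution are determined by the active dual rows and by the slopes
  of the cuts that carry weight, so by backward induction on time only finitely many different cuts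
  can ever be generated.  Call the approximations tight if, at every post-decision state that the
  next forward pass may visit, the time-\<open>t\<close> approximation attains the expected value computed from
  the time-\<open>t + 1\<close> approximation.  If they are not tight, then some scenario, when sampled, creates
  a new cut; scenarios are sampled independently of the past with probabilities bounded away from
  zero, so almost surely this happens only finitely often.  Once the penalty is small, the
  regularized forward decisions are exact minimizers of the unregularized piecewise linear
  problems, uniformly in the state: a non-optimal point has an improving direction that depends only
  on its zero coordinates and its active cuts, and there are finitely many such patterns.  Tightness
  and exactness together propagate equality with the optimal value functions backwards from the
  horizon.
\<close>

section \<open>Finitely many multipliers of basic dual solutions\<close>

text \<open>The linear programs of the backward pass grow without bound, since every iteration
  appends a cut, possibly a copy of an old one. Finiteness therefore cannot come from counting the
  bases of one fixed program; it comes from identifying a dual solution by the set of slopes that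
  carry weight. The trial point and the intercepts of the cuts enter only the dual objective and do
  not affect which points are basic. The intercept of a new cut is then no extra freedom: the
  function that it supports is fixed by the cuts one stage later, and a function has at most one
  supporting hyperplane of a given slope. Failure of tightness is an event of the past alone, and
  the next scenario is independent of the past. So the expected number of failures is at most the
  maximal number of cuts divided by the smallest scenario probability.\<close>

lemma orthogonal_to_basis_imp_zero:
  fixes z :: "real Matrix.vec"
  assumes S: "S \<subseteq> carrier_vec d" "finite S" "card S = d"
    and ind: "\<not> LinearCombinations.module.lin_dep class_ring (module_vec TYPE(real) d) S"
    and z: "z \<in> carrier_vec d" and orth: "\<And>a. a \<in> S \<Longrightarrow> scalar_prod a z = 0"
  shows "z = 0\<^sub>v d"
proof -
  interpret vec_space "TYPE(real)" d .
  have "basis S"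
    using dim_li_is_basis[OF fin_dim S(2)] S ind dim_is_n by simp
  then have "z \<in> span S" using z by (auto simp: basis_def)
  then obtain f where f: "z = lincomb f S"
    using finite_in_span[OF S(2)] S(1) by auto
  have "scalar_prod z z = (\<Sum>a\<in>S. scalar_prod (f a \<cdot>\<^sub>v a) z)"
  proof -
    have "scalar_prod (lincomb f S) z = (\<Sum>a\<in>S. scalar_prod (f a \<cdot>\<^sub>v a) z)"
      unfolding lincomb_def using S z by (subst finsum_scalar_prod_sum) auto
    then show ?thesis using f by simp
  qed
  also have "\<dots> = 0" using orth S z by (intro sum.neutral) auto
  finally have "scalar_prod z z = 0" .
  then have "\<And>i. i < d \<Longrightarrow> vec_index z i = 0"
    using z by (auto simp: scalar_prod_def sum_nonneg_eq_0_iff)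
  then show ?thesis using z by auto
qed

text \<open>On \<open>A\<close> the map \<open>g\<close> factors through \<open>f\<close>. This
  transfers finiteness from the data that determine a multiplier or a cut to the multiplier or the
  cut itself.\<close>

lemma finite_image_determined:
  assumes "finite (f ` A)" and "\<And>x y. x \<in> A \<Longrightarrow> y \<in> A \<Longrightarrow> f x = f y \<Longrightarrow> g x = g y"
  shows "finite (g ` A)"
proof -
  have "g ` A \<subseteq> (\<lambda>u. g (SOME x. x \<in> A \<and> f x = u)) ` f ` A"
  proof
    fix b assume "b \<in> g ` A"
    then obtain x where x: "x \<in> A" "b = g x" by auto
    have "(SOME y. y \<in> A \<and> f y = f x) \<in> A \<and> f (SOME y. y \<in> A \<and> f y = f x) = f x"
      by (rule someI[of "\<lambda>y. y \<in> A \<and> f y = f x" x]) (use x in simp)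
    then have "b = g (SOME y. y \<in> A \<and> f y = f x)" using assms(2) x by metis
    then show "b \<in> (\<lambda>u. g (SOME x. x \<in> A \<and> f x = u)) ` f ` A" using x by blast
  qed
  then show ?thesis using assms(1) by (meson finite_imageI finite_subset)
qed

lemma sum_lessThan_add:
  fixes f :: "nat \<Rightarrow> real"
  shows "(\<Sum>l<m + k. f l) = (\<Sum>l<m. f l) + (\<Sum>j<k. f (m + j))"
  by (induction k) simp_all

text \<open>Component \<open>i\<close> of E^T \<pi> + G^T \<mu>. The rows of G are generated from
  labels, so that programs with different numbers of rows can be compared; the labels will be cut
  slopes.\<close>

definition dual_lhs :: "rmat \<Rightarrow> ('b \<Rightarrow> nat \<Rightarrow> real) \<Rightarrow> 'b list \<Rightarrow> nat \<Rightarrow> rvec \<Rightarrow> real" where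
  "dual_lhs E g bs i y =
     (\<Sum>r<dim_row E. E $$ (r, i) * vec_index y r) +
     (\<Sum>j<length bs. g (bs ! j) i * vec_index y (dim_row E + j))"

lemma scalar_prod_append_col:
  assumes E: "E \<in> carrier_mat m n" and i: "i < n" and y: "y \<in> carrier_vec (m + length bs)"
  shows "scalar_prod (Matrix.col E i @\<^sub>v Matrix.col (Matrix.mat (length bs) n (\<lambda>(j,
      i). g (bs ! j) i)) i) y
    = dual_lhs E g bs i y"
proof -
  let ?a = "Matrix.col E i @\<^sub>v Matrix.col (Matrix.mat (length bs) n (\<lambda>(j, i). g (bs ! j) i)) i"
  have "scalar_prod ?a y = (\<Sum>l<m + length bs. vec_index ?a l * vec_index y l)"
    using y by (simp add: scalar_prod_def atLeast0LessThan)
  also have "\<dots> = (\<Sum>l<m. vec_index ?a l * vec_index y l) +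
      (\<Sum>j<length bs. vec_index ?a (m + j) * vec_index y (m + j))"
    by (rule sum_lessThan_add)
  also have "\<dots> = dual_lhs E g bs i y"
    using E i by (simp add: dual_lhs_def)
  finally show ?thesis .
qed

text \<open>The hypotheses on \<open>z\<close> say that it is annihilated by every constraint row
  active at \<open>y\<close>: by the dual rows in \<open>zI\<close>, by the sign constraints in
  \<open>zJ\<close>. Basicness supplies a full set of independent active rows. Below,
  \<open>z\<close> is an exchange direction or a difference of two solutions.\<close>

lemma basic_solution_nondegenerate:
  assumes E: "lp_E lp \<in> carrier_mat m n" and obj: "dim_vec (lp_obj lp) = n"
    and G: "lp_G lp = Matrix.mat (length bs) n (\<lambda>(j, i). g (bs ! j) i)"
    and basic: "basic_solution (dual_dim lp) (dual_eqs lp) (dual_ineqs lp) y"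
    and z: "z \<in> carrier_vec (m + length bs)"
    and zI: "\<And>i. i < n \<Longrightarrow> dual_lhs (lp_E lp) g bs i y = vec_index (lp_obj lp) i \<Longrightarrow>
        dual_lhs (lp_E lp) g bs i z = 0"
    and zJ: "\<And>j. j < length bs \<Longrightarrow> vec_index y (m + j) = 0 \<Longrightarrow> vec_index z (m + j) = 0"
  shows "z = 0\<^sub>v (m + length bs)"
proof -
  have d: "dual_dim lp = m + length bs" using E G by (simp add: dual_dim_def)
  have y: "y \<in> carrier_vec (m + length bs)" using basic d by (simp add: basic_solution_def)
  obtain S where S: "S \<subseteq> {a. \<exists>r. (a, r) \<in> dual_eqs lp \<union> dual_ineqs lp \<and> scalar_prod a y = r}"
    "finite S" "card S = m + length bs"
    "\<not> LinearCombinations.module.lin_dep class_ring (module_vec TYPE(real) (m + length bs)) S"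
    using basic unfolding basic_solution_def d by auto
  have *: "a \<in> carrier_vec (m + length bs) \<and> scalar_prod a z = 0" if aS: "a \<in> S" for a
  proof -
    obtain r where r: "(a, r) \<in> dual_eqs lp \<union> dual_ineqs lp" "scalar_prod a y = r" using S(1) aS by blast
    then consider i where "i < n" "(a, r) = dual_row lp i"
      | j where "j < length bs" "a = - unit_vec (m + length bs) (m + j)" "r = 0"
      using E G obj d by (auto simp: dual_eqs_def dual_ineqs_def)
    then show ?thesis
    proof cases
      case 1
      have a: "a = Matrix.col (lp_E lp) i @\<^sub>v Matrix.col (Matrix.mat (length bs) n (\<lambda>(j,
          i). g (bs ! j) i)) i"
        and ri: "r = vec_index (lp_obj lp) i"
        using 1 G by (auto simp: dual_row_def)
      have "dual_lhs (lp_E lp) g bs i y = vec_index (lp_obj lp) i"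
        using scalar_prod_append_col[OF E 1(1) y, of g] r(2) ri a by simp
      then have "dual_lhs (lp_E lp) g bs i z = 0" using zI 1(1) by blast
      moreover have "a \<in> carrier_vec (m + length bs)"
        unfolding a by (intro append_carrier_vec carrier_vecI) (use E in simp_all)
      ultimately show ?thesis using scalar_prod_append_col[OF E 1(1) z, of g] a by simp
    next
      case 2
      have "vec_index y (m + j) = 0" using r(2) 2 y by simp
      then show ?thesis using zJ 2 z by simp
    qed
  qed
  show ?thesis
    using orthogonal_to_basis_imp_zero[OF _ S(2,3,4) z] * by blast
qed

text \<open>Labels instead of positions: positions range over ever longer lists, labels over one
  finite set.\<close>

definition dual_support :: "nat \<Rightarrow> 'b list \<Rightarrow> rvec \<Rightarrow> 'b set" where
  "dual_support m bs y = {bs ! j | j. j < length bs \<and> vec_index y (m + j) \<noteq> 0}"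

text \<open>If two copies of a label carried weight, the direction that shifts weight from one to
  the other would be annihilated by all rows active at \<open>y\<close>, contradicting
  basicness.\<close>

lemma basic_solution_inj_on_support:
  assumes E: "lp_E lp \<in> carrier_mat m n" and obj: "dim_vec (lp_obj lp) = n"
    and G: "lp_G lp = Matrix.mat (length bs) n (\<lambda>(j, i). g (bs ! j) i)"
    and basic: "basic_solution (dual_dim lp) (dual_eqs lp) (dual_ineqs lp) y"
  shows "inj_on (\<lambda>j. bs ! j) {j. j < length bs \<and> vec_index y (m + j) \<noteq> 0}"
proof (rule inj_onI, rule ccontr, clarsimp)
  fix p q assume pq: "p < length bs" "q < length bs" "bs ! p = bs ! q" "p \<noteq> q"
    "vec_index y (m + p) \<noteq> 0" "vec_index y (m + q) \<noteq> 0"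
  define z where "z = Matrix.vec (m + length bs) (\<lambda>l. (if l = m + p then 1 else 0) - (if l =
      m + q then 1 else (0::real)))"
  have "z = 0\<^sub>v (m + length bs)"
  proof (rule basic_solution_nondegenerate[OF E obj G basic])
    show "z \<in> carrier_vec (m + length bs)" by (simp add: z_def)
    show "vec_index z (m + j) = 0" if "j < length bs" "vec_index y (m + j) = 0" for j
      using that pq by (auto simp: z_def)
    show "dual_lhs (lp_E lp) g bs i z = 0" for i
    proof -
      have 1: "(\<Sum>r<m. lp_E lp $$ (r, i) * vec_index z r) = 0"
        by (intro sum.neutral) (auto simp: z_def)
      have "(\<Sum>j<length bs. g (bs ! j) i * vec_index z (m + j)) =
          (\<Sum>j<length bs. (if j = p then g (bs ! j) i else 0) - (if j = q then g (bs ! j) i else 0))"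
        by (intro sum.cong) (auto simp: z_def)
      also have "\<dots> = g (bs ! p) i - g (bs ! q) i"
        using pq by (simp add: sum_subtractf)
      finally show ?thesis using 1 E pq by (simp add: dual_lhs_def)
    qed
  qed
  then have "vec_index z (m + p) = 0" using pq by simp
  then show False using pq by (simp add: z_def)
qed

lemma dual_lhs_aggregate:
  assumes "dim_row E = m"
  shows "dual_lhs E g bs i y = (\<Sum>r<m. E $$ (r, i) * vec_index y r) +
    (\<Sum>b\<in>dual_support m bs y. g b i * (\<Sum>j | j < length bs \<and> vec_index y (m + j) \<noteq> 0 \<and> bs ! j =
        b. vec_index y (m + j)))"
proof -
  let ?J = "{j. j < length bs \<and> vec_index y (m + j) \<noteq> 0}"
  have "(\<Sum>j<length bs. g (bs ! j) i * vec_index y (m + j)) = (\<Sum>j\<in>?J. g (bs ! j) i * vec_index y (m + j))"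
    by (intro sum.mono_neutral_right) auto
  also have "\<dots> = (\<Sum>b\<in>(!) bs ` ?J. \<Sum>j | j \<in> ?J \<and> bs ! j = b. g (bs ! j) i * vec_index y (m + j))"
    by (intro sum.image_gen) auto
  also have "(!) bs ` ?J = dual_support m bs y" by (auto simp: dual_support_def)
  finally show ?thesis using assms
    by (auto simp: dual_lhs_def sum_distrib_left conj_assoc intro!: sum.cong)
qed

text \<open>A basic solution puts weight on at most one copy of a repeated cut, so its equality
  multipliers depend only on which dual rows are active and which cuts carry weight.\<close>

lemma basic_solution_multipliers_unique:
  assumes E: "lp_E lp \<in> carrier_mat m n" and obj: "dim_vec (lp_obj lp) = n"
    and G: "lp_G lp = Matrix.mat (length bs) n (\<lambda>(j, i). g (bs ! j) i)"
    and basic: "basic_solution (dual_dim lp) (dual_eqs lp) (dual_ineqs lp) y"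
    and E': "lp_E lp' = lp_E lp" and obj': "lp_obj lp' = lp_obj lp"
    and G': "lp_G lp' = Matrix.mat (length bs') n (\<lambda>(j, i). g (bs' ! j) i)"
    and basic': "basic_solution (dual_dim lp') (dual_eqs lp') (dual_ineqs lp') y'"
    and I: "{i. i < n \<and> dual_lhs (lp_E lp) g bs i y = vec_index (lp_obj lp) i} =
            {i. i < n \<and> dual_lhs (lp_E lp) g bs' i y' = vec_index (lp_obj lp) i}"
    and J: "dual_support m bs y = dual_support m bs' y'"
  shows "vec_first y m = vec_first y' m"
proof -
  define \<mu> where "\<mu> b = (\<Sum>j | j < length bs' \<and> vec_index y' (m + j) \<noteq> 0 \<and> bs' ! j =
      b. vec_index y' (m + j))" for b
  \<comment> \<open>The difference of \<open>y\<close> and \<open>y'\<close>, with the weights of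
    \<open>y'\<close> carried over to the positions of \<open>y\<close> by label. Positions where
    \<open>y\<close> has no weight get 0, as the active sign constraints demand.\<close>
  define z where "z = Matrix.vec (m + length bs) (\<lambda>l. if l < m then vec_index y l - vec_index y' l
     else if vec_index y l = 0 then 0 else vec_index y l - \<mu> (bs ! (l - m)))"
  have rowE: "dim_row (lp_E lp) = m" using E by simp
  have "z = 0\<^sub>v (m + length bs)"
  proof (rule basic_solution_nondegenerate[OF E obj G basic])
    show "z \<in> carrier_vec (m + length bs)" by (simp add: z_def)
    show "vec_index z (m + j) = 0" if "j < length bs" "vec_index y (m + j) = 0" for j
      using that by (auto simp: z_def)
    show "dual_lhs (lp_E lp) g bs i z = 0"
      if i: "i < n" "dual_lhs (lp_E lp) g bs i y = vec_index (lp_obj lp) i" for i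
    proof -
      let ?J = "{j. j < length bs \<and> vec_index y (m + j) \<noteq> 0}"
      have "dual_lhs (lp_E lp) g bs' i y' = vec_index (lp_obj lp) i" using I i by blast
      then have eq: "(\<Sum>r<m. lp_E lp $$ (r, i) * vec_index y r) + (\<Sum>j<length bs. g (bs ! j) i *
          vec_index y (m + j))
        = (\<Sum>r<m. lp_E lp $$ (r, i) * vec_index y' r) + (\<Sum>b\<in>dual_support m bs y. g b i * \<mu> b)"
        using i dual_lhs_aggregate[OF rowE, of g bs' i y'] rowE J by (simp add: \<mu>_def dual_lhs_def)
      have "dual_support m bs y = (!) bs ` ?J" by (auto simp: dual_support_def)
      then have sup: "(\<Sum>b\<in>dual_support m bs y. g b i * \<mu> b) = (\<Sum>j\<in>?J. g (bs ! j) i * \<mu> (bs ! j))"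
        using sum.reindex[OF basic_solution_inj_on_support[OF E obj G basic],
            of "\<lambda>b. g b i * \<mu> b"] by simp
      have 1: "(\<Sum>r<m. lp_E lp $$ (r, i) * vec_index z r) =
          (\<Sum>r<m. lp_E lp $$ (r, i) * vec_index y r) - (\<Sum>r<m. lp_E lp $$ (r, i) * vec_index y' r)"
        unfolding sum_subtractf[symmetric] by (intro sum.cong) (auto simp: z_def algebra_simps)
      have "(\<Sum>j<length bs. g (bs ! j) i * vec_index z (m + j)) =
          (\<Sum>j\<in>?J. g (bs ! j) i * vec_index z (m + j))"
        by (intro sum.mono_neutral_right) (auto simp: z_def)
      also have "\<dots> = (\<Sum>j\<in>?J. g (bs ! j) i * vec_index y (m + j)) - (\<Sum>j\<in>?J. g (bs ! j) i * \<mu> (bs ! j))"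
        unfolding sum_subtractf[symmetric] by (intro sum.cong) (auto simp: z_def algebra_simps)
      also have "(\<Sum>j\<in>?J. g (bs ! j) i * vec_index y (m + j)) =
          (\<Sum>j<length bs. g (bs ! j) i * vec_index y (m + j))"
        by (intro sum.mono_neutral_left) auto
      finally show ?thesis using 1 eq sup rowE by (simp add: dual_lhs_def)
    qed
  qed
  then have "vec_index y r = vec_index y' r" if "r < m" for r
  proof -
    have "vec_index z r = 0" using \<open>z = 0\<^sub>v (m + length bs)\<close> that by simp
    then show ?thesis using that by (simp add: z_def)
  qed
  then show ?thesis by (auto simp: vec_first_def)
qed

text \<open>The components \<open>lp_e\<close> and \<open>lp_g\<close> are left free: they occur
  only in the dual objective, while being basic depends on the dual constraints alone. The pair of
  active rows and weighted labels ranges over a finite set and fixes the multipliers.\<close>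

lemma finite_basic_multipliers:
  fixes g :: "'b \<Rightarrow> nat \<Rightarrow> real"
  assumes "finite B" and E: "E \<in> carrier_mat m n" and c: "dim_vec c = n"
  shows "finite {vec_first y m | lp y bs. lp_E lp = E \<and> lp_obj lp = c \<and> set bs \<subseteq> B \<and>
    lp_G lp = Matrix.mat (length bs) n (\<lambda>(j, i). g (bs ! j) i) \<and>
    basic_solution (dual_dim lp) (dual_eqs lp) (dual_ineqs lp) y}"
proof -
  define P where "P = {p :: lin_prog \<times> rvec \<times> 'b list. case p of (lp, y, bs) \<Rightarrow>
    lp_E lp = E \<and> lp_obj lp = c \<and> set bs \<subseteq> B \<and>
    lp_G lp = Matrix.mat (length bs) n (\<lambda>(j, i). g (bs ! j) i) \<and>
    basic_solution (dual_dim lp) (dual_eqs lp) (dual_ineqs lp) y}"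
  define f where "f = (\<lambda>(lp :: lin_prog, y, bs).
    ({i. i < n \<and> dual_lhs E g bs i y = vec_index c i}, dual_support m bs y))"
  have "f p \<in> Pow {..<n} \<times> Pow B" if "p \<in> P" for p
  proof -
    obtain lp y bs where p: "p = (lp, y, bs)" by (cases p)
    then have "set bs \<subseteq> B" using that by (simp add: P_def)
    then have "dual_support m bs y \<subseteq> B" using nth_mem[of _ bs] by (auto simp: dual_support_def)
    then show ?thesis by (auto simp: p f_def)
  qed
  then have "finite (f ` P)" using assms(1)
    by (intro finite_subset[of "f ` P" "Pow {..<n} \<times> Pow B"]) blast+
  then have "finite ((\<lambda>(lp, y, bs). vec_first y m) ` P)"
  proof (rule finite_image_determined)
    fix p q assume pq: "p \<in> P" "q \<in> P" "f p = f q"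
    obtain lp y bs lp' y' bs' where p: "p = (lp, y, bs)" "q = (lp', y', bs')" by (cases p, cases q)
    have 1: "lp_E lp = E" "lp_obj lp = c" "lp_G lp = Matrix.mat (length bs) n (\<lambda>(j, i). g (bs ! j) i)"
      "basic_solution (dual_dim lp) (dual_eqs lp) (dual_ineqs lp) y"
      "lp_E lp' = E" "lp_obj lp' = c" "lp_G lp' = Matrix.mat (length bs') n (\<lambda>(j, i). g (bs' ! j) i)"
      "basic_solution (dual_dim lp') (dual_eqs lp') (dual_ineqs lp') y'"
      using pq unfolding p P_def by simp_all
    have "vec_first y m = vec_first y' m"
      by (rule basic_solution_multipliers_unique[of lp m n bs g y lp' bs' y'])
        (use E c pq(3) in \<open>simp_all only: 1 p f_def prod.case prod.inject\<close>)
    then show "(\<lambda>(lp, y, bs). vec_first y m) p = (\<lambda>(lp, y, bs). vec_first y m) q" by (simp add: p)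
  qed
  moreover have "{vec_first y m | lp y bs. lp_E lp = E \<and> lp_obj lp = c \<and> set bs \<subseteq> B \<and>
    lp_G lp = Matrix.mat (length bs) n (\<lambda>(j, i). g (bs ! j) i) \<and>
    basic_solution (dual_dim lp) (dual_eqs lp) (dual_ineqs lp) y} \<subseteq> (\<lambda>(lp, y, bs). vec_first y m) ` P"
  proof (clarify)
    fix lp y bs assume *: "set bs \<subseteq> B" "c = lp_obj lp" "E = lp_E lp"
      "lp_G lp = Matrix.mat (length bs) n (\<lambda>(j, i). g (bs ! j) i)"
      "basic_solution (dual_dim lp) (dual_eqs lp) (dual_ineqs lp) y"
    show "vec_first y m \<in> (\<lambda>(lp, y, bs). vec_first y m) ` P"
      by (rule image_eqI[of _ _ "(lp, y, bs)"]) (use * in \<open>simp_all add: P_def\<close>)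
  qed
  ultimately show ?thesis by (rule finite_subset[rotated])
qed

section \<open>Cuts and valid histories\<close>

text \<open>Cuts as affine functions, slope and intercept. Trial points range over a continuum, and
  one affine function can arise at many of them; the cuts can be finite in number only in this
  form.\<close>

definition cut_set :: "'w mslp \<Rightarrow> 'w iteration list \<Rightarrow> nat \<Rightarrow> (rvec \<times> real) set" where
  "cut_set pr h t = (\<lambda>(\<alpha>, \<beta>, R). (\<beta>, \<alpha> - scalar_prod \<beta> R)) ` set (cuts pr h t)"

text \<open>The supremum over the empty set is minus infinity, in agreement with the initial
  approximation.\<close>

definition cut_max :: "(rvec \<times> real) set \<Rightarrow> rvec \<Rightarrow> ereal" where
  "cut_max C R = (SUP (\<beta>, \<gamma>)\<in>C. ereal (scalar_prod \<beta> R + \<gamma>))"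

definition new_cut :: "'w mslp \<Rightarrow> 'w iteration list \<Rightarrow> 'w iteration \<Rightarrow> nat \<Rightarrow> rvec \<times> real" where
  "new_cut pr h it t = (cut_slope pr it t,
     cut_height pr it t (Vbar pr (it # h) (Suc t)) - scalar_prod (cut_slope pr it t) (trial_point pr
         it t))"

lemma cut_set_Nil [simp]: "cut_set pr [] t = {}"
  by (simp add: cut_set_def)

lemma cut_set_Cons: "cut_set pr (it # h) t = insert (new_cut pr h it t) (cut_set pr h t)"
  by (simp add: cut_set_def new_cut_def)

lemma finite_cut_set: "finite (cut_set pr h t)"
  by (simp add: cut_set_def)

lemma Vbar_horizon: "Vbar pr h (horizon pr) = Vstar pr (horizon pr)"
  by (cases h) (simp_all add: backward.simps)

lemma Vbar_mono_history:
  assumes "t \<le> horizon pr"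
  shows "Vbar pr h t R \<le> Vbar pr (it # h) t R"
proof (cases "t = horizon pr")
  case True
  then show ?thesis by (simp only: Vbar_horizon order_refl)
next
  case False
  then show ?thesis using assms by (simp add: backward.simps[of pr it "Vbar pr h" t])
qed

lemma cut_slope_carrier: "cut_slope pr it t \<in> carrier_vec (rdim pr (Suc t))"
  by (simp add: cut_slope_def)

lemma stage_value_mono:
  assumes "wf_stage pr t (info S)"
    and "\<And>R. R \<in> carrier_vec (rdim pr (Suc t)) \<Longrightarrow> V R \<le> V' R"
  shows "stage_value pr t V S \<le> stage_value pr t V' S"
proof -
  have "post S x \<in> carrier_vec (rdim pr (Suc t))" for x
    using assms(1) by (auto simp: post_def wf_stage_def intro!: carrier_vecI)
  then show ?thesis
    unfolding stage_value_def by (intro INF_mono') (auto intro!: add_left_mono assms(2))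
qed

lemma stage_value_cong:
  assumes "wf_stage pr t (info S)"
    and "\<And>R. R \<in> carrier_vec (rdim pr (Suc t)) \<Longrightarrow> V R = V' R"
  shows "stage_value pr t V S = stage_value pr t V' S"
  by (rule antisym) (auto intro!: stage_value_mono assms(1) simp: assms(2))

lemma stage_prob_nonneg: "0 \<le> stage_prob pr t a"
  by (simp add: stage_prob_def)

lemma exp_value_mono:
  assumes "\<And>a. a \<in> outcomes pr t \<Longrightarrow> wf_stage pr t (data pr t a)"
    and "\<And>R. R \<in> carrier_vec (rdim pr (Suc t)) \<Longrightarrow> V R \<le> V' R"
  shows "exp_value pr t V R \<le> exp_value pr t V' R"
  unfolding exp_value_def
  by (intro sum_mono ereal_mult_left_mono stage_value_mono) (auto simp: assms stage_prob_nonneg)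

text \<open>Each subgradient inequality, evaluated at the other point, compares the two intercepts
  in one direction.\<close>

lemma subdifferential_intercept_unique:
  assumes "g \<in> subdifferential d f R" "g \<in> subdifferential d f R'"
    "R \<in> carrier_vec d" "R' \<in> carrier_vec d"
  shows "real_of_ereal (f R) - scalar_prod g R = real_of_ereal (f R') - scalar_prod g R'"
proof -
  have g: "g \<in> carrier_vec d" and fin: "\<bar>f R\<bar> \<noteq> \<infinity>" "\<bar>f R'\<bar> \<noteq> \<infinity>"
    and le: "f R + ereal (scalar_prod g (R' - R)) \<le> f R'" "f R' + ereal (scalar_prod g (R - R')) \<le> f R"
    using assms by (auto simp: subdifferential_def)
  obtain r r' where r: "f R = ereal r" "f R' = ereal r'" using fin by (cases "f R"; cases "f R'") auto
  show ?thesis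
    using le r scalar_prod_minus_distrib[OF g assms(4,3)] scalar_prod_minus_distrib[OF g assms(3,4)]
    by simp
qed

text \<open>Collects the pathwise conditions of a run, so that probability enters only at the end.
  The condition on the selections made from \<open>h\<close> is recorded with the next iteration;
  hence statements about the forward pass after \<open>h\<close> assume validity of
  \<open>it # h\<close>.\<close>

primrec valid_history ::
  "'w mslp \<Rightarrow> (nat \<Rightarrow> rmat) \<Rightarrow> (nat \<Rightarrow> real) \<Rightarrow> 'w rule \<Rightarrow> 'w iteration list \<Rightarrow> bool" where
  "valid_history pr Q \<rho> sel [] \<longleftrightarrow> True"
| "valid_history pr Q \<rho> sel (it # h) \<longleftrightarrow> valid_history pr Q \<rho> sel h \<and> scen it \<in> scenarios pr \<and>
     forward_ok pr Q \<rho> sel h it \<and> backward_ok pr h it \<and> dual_basic_used pr h it"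

locale qrm =
  fixes pr :: "'w mslp" and Q :: "nat \<Rightarrow> rmat" and \<rho> :: "nat \<Rightarrow> real" and sel :: "'w rule"
  assumes wf: "wf_mslp pr"
    and indep: "stagewise_independent pr"
    and recourse: "relatively_complete_recourse pr"
    and psd: "\<forall>t\<le>horizon pr. psd_mat (rdim pr (Suc t)) (Q t)"
    and pos_prob: "\<forall>v\<in>scenarios pr. 0 < pmf (law pr) v"
    and penalty_nonneg: "\<forall>k. 0 \<le> \<rho> k"
    and bounded: "bounded_feasible_sets pr"
begin

abbreviation valid :: "'w iteration list \<Rightarrow> bool" where
  "valid \<equiv> valid_history pr Q \<rho> sel"

abbreviation T :: nat where "T \<equiv> horizon pr"

lemma finite_outcomes: "1 \<le> t \<Longrightarrow> t \<le> T \<Longrightarrow> finite (outcomes pr t)"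
  using wf by (simp add: wf_mslp_def)

lemma wf_data: "1 \<le> t \<Longrightarrow> t \<le> T \<Longrightarrow> a \<in> outcomes pr t \<Longrightarrow> wf_stage pr t (data pr t a)"
  using wf by (simp add: wf_mslp_def)

lemma scenario_outcome: "v \<in> scenarios pr \<Longrightarrow> 1 \<le> t \<Longrightarrow> t \<le> T \<Longrightarrow> v t \<in> outcomes pr t"
  using wf unfolding wf_mslp_def by (meson PiE_mem atLeastAtMost_iff subsetD)

lemma wf_data_along: "v \<in> scenarios pr \<Longrightarrow> t \<le> T \<Longrightarrow> wf_stage pr t (data_along pr v t)"
  using wf wf_data[of t "v t"] scenario_outcome[of v t]
  by (cases "t = 0") (auto simp: data_along_def wf_mslp_def)

lemma trial_point_carrier:
  assumes "scen it \<in> scenarios pr" "t \<le> T"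
  shows "trial_point pr it t \<in> carrier_vec (rdim pr (Suc t))"
  using wf_data_along[OF assms] by (auto simp: trial_point_def wf_stage_def intro!: carrier_vecI)

section \<open>Approximations as maxima of cuts that bound the value functions from below\<close>

lemma Vbar_eq_cut_max:
  assumes "valid h" "t < T" "R \<in> carrier_vec (rdim pr (Suc t))"
  shows "Vbar pr h t R = cut_max (cut_set pr h t) R"
  using assms(1)
proof (induction h)
  case Nil
  then show ?case using assms(2) by (simp add: cut_max_def bot_ereal_def)
next
  case (Cons it h)
  have tp: "trial_point pr it t \<in> carrier_vec (rdim pr (Suc t))"
    using Cons.prems assms(2) by (simp add: trial_point_carrier)
  have "Vbar pr (it # h) t R = max (Vbar pr h t R)
      (ereal (scalar_prod (fst (new_cut pr h it t)) R + snd (new_cut pr h it t)))"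
    using assms(2) scalar_prod_minus_distrib[OF cut_slope_carrier assms(3) tp, of it]
    by (simp add: backward.simps[of pr it "Vbar pr h" t] new_cut_def add.commute add_diff_eq)
  then show ?case using Cons
    by (simp add: cut_set_Cons cut_max_def case_prod_unfold sup_max max.commute)
qed

lemma subgradient:
  assumes "valid (it # h)" "t < T" "a \<in> outcomes pr (Suc t)"
  shows "subg it (Suc t) a \<in> subdifferential (rdim pr (Suc t))
    (\<lambda>R. stage_value pr (Suc t) (Vbar pr (it # h) (Suc t)) (Pre R (data pr (Suc t) a))) (trial_point
        pr it t)"
proof -
  have "Suc t \<in> {1..T}" using assms(2) by simp
  then show ?thesis using assms unfolding valid_history.simps backward_ok_def
    by (metis diff_Suc_1)
qed

lemma cut_slope_scalar_prod:
  assumes "valid (it # h)" "t < T" "R \<in> carrier_vec (rdim pr (Suc t))"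
  shows "scalar_prod (cut_slope pr it t) R =
    (\<Sum>a\<in>outcomes pr (Suc t). stage_prob pr (Suc t) a * scalar_prod (subg it (Suc t) a) R)"
proof -
  have "scalar_prod (cut_slope pr it t) R = (\<Sum>i<rdim pr (Suc t). \<Sum>a\<in>outcomes pr (Suc t).
      stage_prob pr (Suc t) a * vec_index (subg it (Suc t) a) i * vec_index R i)"
    using assms(3) by (simp add: scalar_prod_def cut_slope_def sum_distrib_right atLeast0LessThan)
  also have "\<dots> = (\<Sum>a\<in>outcomes pr (Suc t). \<Sum>i<rdim pr (Suc t).
      stage_prob pr (Suc t) a * vec_index (subg it (Suc t) a) i * vec_index R i)"
    by (rule sum.swap)
  finally show ?thesis using assms(3)
    by (simp add: scalar_prod_def sum_distrib_left mult.assoc atLeast0LessThan)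
qed

text \<open>A subgradient exists only where the stage value is finite, so the expectation is a
  genuine real average and the conversion in \<open>cut_height\<close> loses nothing.\<close>

lemma exp_value_trial_point:
  assumes "valid (it # h)" "t < T"
  shows "exp_value pr (Suc t) (Vbar pr (it # h) (Suc t)) (trial_point pr it t) =
    ereal (\<Sum>a\<in>outcomes pr (Suc t). stage_prob pr (Suc t) a * real_of_ereal
      (stage_value pr (Suc t) (Vbar pr (it # h) (Suc t)) (Pre (trial_point pr it t) (data pr (Suc t)
          a))))"
  unfolding exp_value_def sum_ereal[symmetric]
proof (rule sum.cong[OF refl])
  fix a assume "a \<in> outcomes pr (Suc t)"
  from subgradient[OF assms this]
  show "ereal (stage_prob pr (Suc t) a) *
         stage_value pr (Suc t) (Vbar pr (it # h) (Suc t)) (Pre (trial_point pr it t) (data pr (Suc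
             t) a)) =
    ereal (stage_prob pr (Suc t) a * real_of_ereal
      (stage_value pr (Suc t) (Vbar pr (it # h) (Suc t)) (Pre (trial_point pr it t) (data pr (Suc t)
          a))))"
    by (auto simp: subdifferential_def ereal_real simp flip: times_ereal.simps(1))
qed

lemma cut_height_eq:
  assumes "valid (it # h)" "t < T"
  shows "cut_height pr it t (Vbar pr (it # h) (Suc t)) =
    (\<Sum>a\<in>outcomes pr (Suc t). stage_prob pr (Suc t) a * real_of_ereal
      (stage_value pr (Suc t) (Vbar pr (it # h) (Suc t)) (Pre (trial_point pr it t) (data pr (Suc t)
          a))))"
  unfolding cut_height_def exp_value_trial_point[OF assms] by simp

text \<open>The cut is the probability-weighted average of the subgradient inequalities of the
  individual outcomes.\<close>

lemma cut_le_exp_value: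
  assumes "valid (it # h)" "t < T" and R: "R \<in> carrier_vec (rdim pr (Suc t))"
  shows "ereal (cut_height pr it t (Vbar pr (it # h) (Suc t)) +
      scalar_prod (cut_slope pr it t) (R - trial_point pr it t))
    \<le> exp_value pr (Suc t) (Vbar pr (it # h) (Suc t)) R"
proof -
  let ?f = "\<lambda>a R. stage_value pr (Suc t) (Vbar pr (it # h) (Suc t)) (Pre R (data pr (Suc t) a))"
  let ?R = "trial_point pr it t"
  have tp: "?R \<in> carrier_vec (rdim pr (Suc t))" using assms by (simp add: trial_point_carrier)
  then have d: "R - ?R \<in> carrier_vec (rdim pr (Suc t))" using R by simp
  have "cut_height pr it t (Vbar pr (it # h) (Suc t)) + scalar_prod (cut_slope pr it t) (R - ?R) =
    (\<Sum>a\<in>outcomes pr (Suc t). stage_prob pr (Suc t) a *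
       (real_of_ereal (?f a ?R) + scalar_prod (subg it (Suc t) a) (R - ?R)))"
    unfolding cut_height_eq[OF assms(1,2)] cut_slope_scalar_prod[OF assms(1,2) d]
    by (simp add: sum.distrib distrib_left)
  also have "ereal \<dots> = (\<Sum>a\<in>outcomes pr (Suc t). ereal (stage_prob pr (Suc t) a) *
       ereal (real_of_ereal (?f a ?R) + scalar_prod (subg it (Suc t) a) (R - ?R)))"
    by (simp flip: sum_ereal)
  also have "\<dots> \<le> exp_value pr (Suc t) (Vbar pr (it # h) (Suc t)) R"
    unfolding exp_value_def
  proof (intro sum_mono ereal_mult_left_mono)
    fix a assume a: "a \<in> outcomes pr (Suc t)"
    have fin: "\<bar>?f a ?R\<bar> \<noteq> \<infinity>" and le: "?f a ?R + ereal (scalar_prod (subg it (Suc t) a) (R - ?R)) \<le>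
        ?f a R"
      using subgradient[OF assms(1,2) a] R by (auto simp: subdifferential_def)
    show "ereal (real_of_ereal (?f a ?R) + scalar_prod (subg it (Suc t) a) (R - ?R)) \<le> ?f a R"
      using le fin unfolding plus_ereal.simps(1)[symmetric] by (simp add: ereal_real)
  qed (simp add: stage_prob_nonneg)
  finally show ?thesis .
qed

text \<open>At its own trial point the new cut equals the expected value computed from the updated
  approximation, so the tightness inequality holds at the states just visited.\<close>

lemma exp_value_le_Vbar_trial_point:
  assumes "valid (it # h)" "t < T"
  shows "exp_value pr (Suc t) (Vbar pr (it # h) (Suc t)) (trial_point pr it t) \<le>
      Vbar pr (it # h) t (trial_point pr it t)"
proof -
  have tp: "trial_point pr it t \<in> carrier_vec (rdim pr (Suc t))" using assms by (simp add:
      trial_point_carrier)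
  have "trial_point pr it t - trial_point pr it t = 0\<^sub>v (rdim pr (Suc t))" using tp by auto
  then have "scalar_prod (cut_slope pr it t) (trial_point pr it t - trial_point pr it t) = 0"
    using cut_slope_carrier[of pr it t] by simp
  moreover have "exp_value pr (Suc t) (Vbar pr (it # h) (Suc t)) (trial_point pr it t)
      = ereal (cut_height pr it t (Vbar pr (it # h) (Suc t)))"
    using exp_value_trial_point[OF assms] cut_height_eq[OF assms] by simp
  ultimately show ?thesis using assms(2) by (simp add: backward.simps[of pr it "Vbar pr h" t])
qed

lemma Vbar_le_Vstar:
  assumes "valid h" "t \<le> T" "R \<in> carrier_vec (rdim pr (Suc t))"
  shows "Vbar pr h t R \<le> Vstar pr t R"
  using assms
proof (induction h arbitrary: t R)
  case Nil
  then show ?case by (cases "t = T") auto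
next
  case (Cons it h)
  \<comment> \<open>A second induction, backwards in time: the new cut at \<open>t\<close> is
    computed from the approximation at \<open>t + 1\<close> already updated in the same backward
    pass.\<close>
  show ?case using Cons.prems(2,3)
  proof (induction arbitrary: R rule: inc_induct)
    case base
    then show ?case by (simp add: Vbar_horizon del: Vbar.simps)
  next
    case (step t)
    have "exp_value pr (Suc t) (Vbar pr (it # h) (Suc t)) R \<le> exp_value pr (Suc t) (Vstar pr (Suc t)) R"
      by (rule exp_value_mono) (use step wf_data in auto)
    also have "\<dots> = Vstar pr t R" using step by (simp add: Vstar.simps[of pr t])
    finally have "ereal (cut_height pr it t (Vbar pr (it # h) (Suc t)) +
        scalar_prod (cut_slope pr it t) (R - trial_point pr it t)) \<le> Vstar pr t R"
      using cut_le_exp_value[OF Cons.prems(1) step.hyps(2) step.prems] order_trans by blast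
    moreover have "Vbar pr h t R \<le> Vstar pr t R" using Cons step by simp
    ultimately show ?case using step by (simp add: backward.simps[of pr it "Vbar pr h" t])
  qed
qed

end

section \<open>Finitely many cuts\<close>

context qrm
begin

lemma finite_subgradients:
  assumes t: "1 \<le> t" "t \<le> T" and a: "a \<in> outcomes pr t"
    and F: "finite F" "\<And>h. valid h \<Longrightarrow> t < T \<Longrightarrow> cut_set pr h t \<subseteq> F"
  shows "finite {subg it t a | it h. valid (it # h)}"
proof -
  define D where "D = data pr t a"
  define n where "n = xdim pr t"
  define m where "m = rdim pr t"
  have D: "Amat D \<in> carrier_mat m n" "cvec D \<in> carrier_vec n"
    using wf_data[OF t a] by (auto simp: wf_stage_def D_def m_def n_def)
  have sub: "\<exists>y R. basic_solution (dual_dim (stage_lp pr (it # h) t R a)) (dual_eqs (stage_lp pr (it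
      # h) t R a))
      (dual_ineqs (stage_lp pr (it # h) t R a)) y \<and> subg it t a = - vec_first y m"
    if "valid (it # h)" for it h
    using that t a unfolding valid_history.simps dual_basic_used_def dual_basic_optimal_def m_def
    by (metis atLeastAtMost_iff)
  show ?thesis
  proof (cases "t < T")
    case True
    define E where "E = Matrix.mat m (n + 1) (\<lambda>(i, j). if j < n then Amat D $$ (i, j) else 0)"
    define c where "c = cvec D @\<^sub>v Matrix.vec 1 (\<lambda>_. 1::real)"
    \<comment> \<open>The row of \<open>lp_G\<close> that belongs to slope \<open>\<beta>\<close>;
      the last column is that of \<theta>. The intercept of a cut enters only \<open>lp_g\<close>,
      so slopes suffice as labels.\<close>
    define g where "g \<beta> j = (if j < n then - scalar_prod \<beta> (Matrix.col (Bmat D) j) else 1)" for \<beta> j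
    let ?\<Pi> = "{vec_first y m | lp y bs. lp_E lp = E \<and> lp_obj lp = c \<and> set bs \<subseteq> fst ` F \<and>
      lp_G lp = Matrix.mat (length bs) (n + 1) (\<lambda>(j, i). g (bs ! j) i) \<and>
      basic_solution (dual_dim lp) (dual_eqs lp) (dual_ineqs lp) y}"
    have "finite ?\<Pi>"
      by (rule finite_basic_multipliers) (use F(1) D in \<open>auto simp: E_def c_def\<close>)
    moreover have "{subg it t a | it h. valid (it # h)} \<subseteq> uminus ` ?\<Pi>"
    proof clarify
      fix it h assume v: "valid (it # h)"
      obtain y R where y: "basic_solution (dual_dim (stage_lp pr (it # h) t R a)) (dual_eqs
          (stage_lp pr (it # h) t R a))
          (dual_ineqs (stage_lp pr (it # h) t R a)) y" "subg it t a = - vec_first y m"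
        using sub[OF v] by blast
      define bs where "bs = map (\<lambda>(\<alpha>, \<beta>, R). \<beta>) (cuts pr (it # h) t)"
      have "set bs = fst ` cut_set pr (it # h) t"
        unfolding bs_def cut_set_def by (simp add: image_image case_prod_unfold)
      then have "set bs \<subseteq> fst ` F" using F(2)[OF v True] by blast
      moreover have "lp_E (stage_lp pr (it # h) t R a) = E" "lp_obj (stage_lp pr (it # h) t R a) = c"
        using True unfolding stage_lp_def Let_def E_def c_def D_def n_def m_def by simp_all
      moreover have "lp_G (stage_lp pr (it # h) t R a) = Matrix.mat (length bs) (n + 1) (\<lambda>(j,
          i). g (bs ! j) i)"
        using True by (auto simp: stage_lp_def Let_def g_def D_def n_def bs_def case_prod_unfold
            simp del: cuts.simps
            intro!: eq_matI)
      ultimately show "subg it t a \<in> uminus ` ?\<Pi>" using y by blast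
    qed
    ultimately show ?thesis by (meson finite_imageI finite_subset)
  next
    case False
    \<comment> \<open>At the horizon there are no cuts: the label type is trivial and only the empty
      list of labels occurs.\<close>
    let ?\<Pi> = "{vec_first y m | lp y bs. lp_E lp = Amat D \<and> lp_obj lp = cvec D \<and> set bs \<subseteq> ({} ::
        unit set) \<and>
      lp_G lp = Matrix.mat (length bs) n (\<lambda>(j, i). (\<lambda>_ _. 0) (bs ! j) i) \<and>
      basic_solution (dual_dim lp) (dual_eqs lp) (dual_ineqs lp) y}"
    have "finite ?\<Pi>"
      by (rule finite_basic_multipliers) (use D in auto)
    moreover have "{subg it t a | it h. valid (it # h)} \<subseteq> uminus ` ?\<Pi>"
    proof clarify
      fix it h assume v: "valid (it # h)"
      obtain y R where y: "basic_solution (dual_dim (stage_lp pr (it # h) t R a)) (dual_eqs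
          (stage_lp pr (it # h) t R a))
          (dual_ineqs (stage_lp pr (it # h) t R a)) y" "subg it t a = - vec_first y m"
        using sub[OF v] by blast
      have "lp_E (stage_lp pr (it # h) t R a) = Amat D" "lp_obj (stage_lp pr (it # h) t R a) = cvec D"
        "lp_G (stage_lp pr (it # h) t R a) = Matrix.mat (length ([] :: unit list)) n (\<lambda>(j,
            i). (\<lambda>_ _. 0) (([] :: unit list) ! j) i)"
        "set ([] :: unit list) \<subseteq> {}"
        using False by (auto simp: stage_lp_def Let_def D_def n_def intro!: eq_matI)
      then show "subg it t a \<in> uminus ` ?\<Pi>" using y by blast
    qed
    ultimately show ?thesis by (meson finite_imageI finite_subset)
  qed
qed

text \<open>The trial points may differ. Equal cuts at \<open>t + 1\<close> give equal stage value
  functions, and two tangents to one function with a common slope have a common intercept.\<close>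

lemma new_cut_determined:
  assumes v: "valid (it # h)" "valid (it' # h')" and t: "t < T"
    and V: "Suc t < T \<Longrightarrow> cut_set pr (it # h) (Suc t) = cut_set pr (it' # h') (Suc t)"
    and g: "\<And>a. a \<in> outcomes pr (Suc t) \<Longrightarrow> subg it (Suc t) a = subg it' (Suc t) a"
  shows "new_cut pr h it t = new_cut pr h' it' t"
proof -
  have slope: "cut_slope pr it t = cut_slope pr it' t"
    unfolding cut_slope_def by (intro eq_vecI) (simp_all add: g)
  let ?f = "\<lambda>a R. stage_value pr (Suc t) (Vbar pr (it # h) (Suc t)) (Pre R (data pr (Suc t) a))"
  let ?f' = "\<lambda>a R. stage_value pr (Suc t) (Vbar pr (it' # h') (Suc t)) (Pre R (data pr (Suc t) a))"
  let ?R = "trial_point pr it t" and ?R' = "trial_point pr it' t"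
  have Veq: "Vbar pr (it # h) (Suc t) R = Vbar pr (it' # h') (Suc t) R"
      if "R \<in> carrier_vec (rdim pr (Suc (Suc t)))" for R
  proof (cases "Suc t < T")
    case True
    then show ?thesis using Vbar_eq_cut_max[OF v(1) True that] Vbar_eq_cut_max[OF v(2) True that] V
        by simp
  next
    case False
    then have "Suc t = T" using t by simp
    then show ?thesis by (simp only: Vbar_horizon)
  qed
  have f: "?f' a R = ?f a R" if "a \<in> outcomes pr (Suc t)" for a R
    by (rule stage_value_cong) (use wf_data that t Veq in auto)
  have R: "?R \<in> carrier_vec (rdim pr (Suc t))" "?R' \<in> carrier_vec (rdim pr (Suc t))"
    using v t by (simp_all add: trial_point_carrier)
  have "real_of_ereal (?f a ?R) - scalar_prod (subg it (Suc t) a) ?R =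
      real_of_ereal (?f' a ?R') - scalar_prod (subg it' (Suc t) a) ?R'" if a:
          "a \<in> outcomes pr (Suc t)" for a
    using subdifferential_intercept_unique[OF subgradient[OF v(1) t a] _ R] subgradient[OF v(2) t a]
        f[OF a] g[OF a]
    by simp
  then have "(\<Sum>a\<in>outcomes pr (Suc t). stage_prob pr (Suc t) a * (real_of_ereal (?f a ?R) -
      scalar_prod (subg it (Suc t) a) ?R)) =
    (\<Sum>a\<in>outcomes pr (Suc t). stage_prob pr (Suc t) a * (real_of_ereal (?f' a ?R') - scalar_prod
        (subg it' (Suc t) a) ?R'))"
    by (intro sum.cong) simp_all
  then show ?thesis
    unfolding new_cut_def cut_height_eq[OF v(1) t] cut_height_eq[OF v(2) t]
      cut_slope_scalar_prod[OF v(1) t R(1)] cut_slope_scalar_prod[OF v(2) t R(2)]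
    by (simp only: slope prod.inject sum_subtractf right_diff_distrib simp_thms)
qed

lemma finitely_many_cuts:
  assumes "t \<le> T"
  shows "\<exists>F. finite F \<and> (\<forall>h. valid h \<longrightarrow> t < T \<longrightarrow> cut_set pr h t \<subseteq> F)"
  using assms
proof (induction rule: inc_induct)
  case base
  then show ?case by auto
next
  case (step t)
  then obtain F where F: "finite F" "\<And>h. valid h \<Longrightarrow> Suc t < T \<Longrightarrow> cut_set pr h (Suc t) \<subseteq> F" by blast
  let ?O = "outcomes pr (Suc t)"
  define P where "P = {(it, h). valid (it # h)}"
  \<comment> \<open>The data that determine the new cut: the cuts one stage later and the
    subgradients of all outcomes. Restricting to the outcomes puts the latter into a finite
    product.\<close>
  define f where "f = (\<lambda>(it, h). (if Suc t < T then cut_set pr (it # h) (Suc t) else {},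
      restrict (subg it (Suc t)) ?O))"
  define G where "G a = {subg it (Suc t) a | it h. valid (it # h)}" for a
  have "finite (G a)" if "a \<in> ?O" for a
    unfolding G_def by (rule finite_subgradients) (use step that F in auto)
  then have fin: "finite (Pow F \<times> Pi\<^sub>E ?O G)"
    using F(1) step finite_outcomes by (intro finite_SigmaI finite_PiE) auto
  have "f ` P \<subseteq> Pow F \<times> Pi\<^sub>E ?O G"
  proof (rule image_subsetI)
    fix p assume "p \<in> P"
    then obtain it h where p: "p = (it, h)" "valid (it # h)" by (auto simp: P_def)
    have "cut_set pr (it # h) (Suc t) \<subseteq> F" if "Suc t < T" using F(2)[OF p(2) that] .
    moreover have "restrict (subg it (Suc t)) ?O \<in> Pi\<^sub>E ?O G"
        using p(2) unfolding G_def restrict_PiE_iff by blast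
    ultimately show "f p \<in> Pow F \<times> Pi\<^sub>E ?O G" by (simp add: f_def p(1))
  qed
  then have "finite (f ` P)" using fin finite_subset by blast
  then have "finite ((\<lambda>(it, h). new_cut pr h it t) ` P)"
  proof (rule finite_image_determined)
    fix p q assume "p \<in> P" "q \<in> P" and eq: "f p = f q"
    then obtain it h it' h' where p: "p = (it, h)" "q = (it', h')" and v: "valid (it # h)"
        "valid (it' # h')"
      by (auto simp: P_def)
    have "new_cut pr h it t = new_cut pr h' it' t"
    proof (rule new_cut_determined[OF v step.hyps(2)])
      show "cut_set pr (it # h) (Suc t) = cut_set pr (it' # h') (Suc t)" if "Suc t < T"
        using eq that by (simp add: f_def p)
      show "subg it (Suc t) a = subg it' (Suc t) a" if "a \<in> ?O" for a
        using eq that by (auto simp: f_def p dest: fun_cong[of _ _ a])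
    qed
    then show "(\<lambda>(it, h). new_cut pr h it t) p = (\<lambda>(it, h). new_cut pr h it t) q" by (simp add: p)
  qed
  moreover have "cut_set pr h t \<subseteq> (\<lambda>(it, h). new_cut pr h it t) ` P" if "valid h" for h
    using that
  proof (induction h)
    case (Cons it h)
    have "(it, h) \<in> P" using Cons.prems by (simp add: P_def)
    then have "new_cut pr h it t \<in> (\<lambda>(it, h). new_cut pr h it t) ` P" by (force intro: rev_image_eqI)
    then show ?case using Cons by (simp add: cut_set_Cons)
  qed simp
  ultimately show ?case by blast
qed

end

section \<open>Exactness of small quadratic penalties\<close>

lemma eventually_at_right_mult_less:
  fixes a b :: real
  assumes "0 < a"
  shows "eventually (\<lambda>s. s * b < a) (at_right 0)"
proof -
  have "((\<lambda>s. s * b) \<longlongrightarrow> 0 * b) (at_right 0)" by (intro tendsto_intros)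
  then show ?thesis using assms by (auto dest: order_tendstoD(2)[of _ _ _ a])
qed

lemma cut_max_finite:
  assumes "finite C" "C \<noteq> {}"
  obtains \<mu> where "cut_max C R = ereal \<mu>" "\<And>\<beta> \<gamma>. (\<beta>, \<gamma>) \<in> C \<Longrightarrow> scalar_prod \<beta> R + \<gamma> \<le> \<mu>"
    "\<exists>(\<beta>, \<gamma>)\<in>C. scalar_prod \<beta> R + \<gamma> = \<mu>"
proof -
  let ?M = "(\<lambda>(\<beta>, \<gamma>). scalar_prod \<beta> R + \<gamma>) ` C"
  have M: "finite ?M" "?M \<noteq> {}" using assms by auto
  have "cut_max C R = Sup (ereal ` ?M)"
    by (simp add: cut_max_def image_image case_prod_unfold)
  also have "\<dots> = ereal (Max ?M)"
  proof (rule Sup_eqI)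
    show "y \<le> ereal (Max ?M)" if "y \<in> ereal ` ?M" for y
      using that Max_ge[OF M(1)] by (metis (no_types, lifting) ereal_less_eq(3) imageE)
    show "ereal (Max ?M) \<le> y" if "\<And>z. z \<in> ereal ` ?M \<Longrightarrow> z \<le> y" for y
      using that Max_in[OF M] by blast
  qed
  finally have "cut_max C R = ereal (Max ?M)" .
  moreover have "Max ?M \<in> ?M" using M by (rule Max_in)
  moreover have "scalar_prod \<beta> R + \<gamma> \<le> Max ?M" if "(\<beta>, \<gamma>) \<in> C" for \<beta> \<gamma>
    using M(1) that by (intro Max_ge) force+
  ultimately show ?thesis by (intro that[of "Max ?M"]) force+
qed

definition active_cuts :: "(rvec \<times> real) set \<Rightarrow> rvec \<Rightarrow> (rvec \<times> real) set" where
  "active_cuts C R = {(\<beta>, \<gamma>)\<in>C. ereal (scalar_prod \<beta> R + \<gamma>) = cut_max C R}"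

text \<open>\<open>d\<close> improves the linear objective at every point whose zero coordinates are \<open>I\<close> and whose
  active cuts are \<open>J\<close>, no matter what the right-hand side of the constraints is.\<close>

definition improving :: "nat \<Rightarrow> stage_data \<Rightarrow> nat set \<Rightarrow> (rvec \<times> real) set \<Rightarrow> rvec \<Rightarrow> bool" where
  "improving n D I J d \<longleftrightarrow> d \<in> carrier_vec n \<and> (\<forall>r<dim_row (Amat D). vec_index (Amat D *\<^sub>v d) r = 0) \<and>
     (\<forall>i\<in>I. 0 \<le> vec_index d i) \<and>
     (\<forall>(\<beta>, \<gamma>)\<in>J. scalar_prod (cvec D) d + scalar_prod \<beta> (Bmat D *\<^sub>v d) < 0)"

text \<open>One description for both kinds of states, with zero as the previous resource state at
  time 0. For given data the state enters only through the right-hand side.\<close>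

lemma feasible_iff:
  assumes "Amat (info S) \<in> carrier_mat m n"
  shows "x \<in> feasible n S \<longleftrightarrow> x \<in> carrier_vec n \<and> (\<forall>i<n. 0 \<le> vec_index x i) \<and> dim_vec (bvec (info S)) = m \<and>
    (\<forall>r<m. vec_index (Amat (info S) *\<^sub>v x) r = vec_index (bvec (info S)) r -
       (case S of Init _ \<Rightarrow> 0 | Pre R _ \<Rightarrow> vec_index R r))"
proof -
  have eq: "u = b \<longleftrightarrow> dim_vec b = dim_vec u \<and> (\<forall>r<dim_vec u. vec_index u r = vec_index b r)"
      for u b :: rvec
    by (auto intro: eq_vecI)
  have nonneg: "0\<^sub>v n \<le> x \<longleftrightarrow> (\<forall>i<n. 0 \<le> vec_index x i)" if "x \<in> carrier_vec n"
    using that by (auto simp: less_eq_vec_def)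
  show ?thesis
  proof (cases S)
    case (Init D)
    then show ?thesis using assms nonneg by (auto simp: eq[of _ "bvec D"])
  next
    case (Pre R D)
    then show ?thesis using assms nonneg by (auto simp: eq[of _ "bvec D"] algebra_simps)
  qed
qed

lemma feasible_add:
  assumes A: "Amat (info S) \<in> carrier_mat m n" and x: "x \<in> feasible n S"
    and d: "d \<in> carrier_vec n" "\<forall>r<m. vec_index (Amat (info S) *\<^sub>v d) r = 0"
    and nonneg: "\<forall>i<n. 0 \<le> vec_index x i + vec_index d i"
  shows "x + d \<in> feasible n S"
proof -
  have "x \<in> carrier_vec n" using x A by (simp add: feasible_iff)
  then have "vec_index (Amat (info S) *\<^sub>v (x + d)) r = vec_index (Amat (info S) *\<^sub>v x) r" if "r < m"
      for r
    using that d A by (simp add: mult_add_distrib_mat_vec)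
  then show ?thesis using assms by (simp add: feasible_iff)
qed

lemma feasible_diff:
  assumes A: "Amat (info S) \<in> carrier_mat m n" and x: "x \<in> feasible n S" "x' \<in> feasible n S" and r:
      "r < m"
  shows "vec_index (Amat (info S) *\<^sub>v (x' - x)) r = 0"
proof -
  have c: "x \<in> carrier_vec n" "x' \<in> carrier_vec n" using x A by (simp_all add: feasible_iff)
  then have "Amat (info S) *\<^sub>v (x' - x) = Amat (info S) *\<^sub>v x' - Amat (info S) *\<^sub>v x"
    using A by (simp add: mult_minus_distrib_mat_vec)
  then show ?thesis using x A r by (simp add: feasible_iff)
qed

lemma quadratic_form_add:
  fixes Q :: rmat
  assumes Q: "Q \<in> carrier_mat p p" "transpose_mat Q = Q" and r: "r \<in> carrier_vec p" and w:
      "w \<in> carrier_vec p"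
  shows "scalar_prod (r + s \<cdot>\<^sub>v w) (Q *\<^sub>v (r + s \<cdot>\<^sub>v w)) =
    scalar_prod r (Q *\<^sub>v r) + 2 * s * scalar_prod r (Q *\<^sub>v w) + s\<^sup>2 * scalar_prod w (Q *\<^sub>v w)"
proof -
  have sw: "s \<cdot>\<^sub>v w \<in> carrier_vec p" using w by simp
  have sym: "scalar_prod w (Q *\<^sub>v r) = scalar_prod r (Q *\<^sub>v w)"
    using transpose_vec_mult_scalar[OF Q(1) r w] Q(2) comm_scalar_prod[of "Q *\<^sub>v w" p r] Q(1) r w by simp
  have "scalar_prod (r + s \<cdot>\<^sub>v w) (Q *\<^sub>v (r + s \<cdot>\<^sub>v w)) =
      scalar_prod r (Q *\<^sub>v r) + scalar_prod r (Q *\<^sub>v (s \<cdot>\<^sub>v w)) + (scalar_prod (s \<cdot>\<^sub>v w) (Q *\<^sub>v r) +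
          scalar_prod (s \<cdot>\<^sub>v w) (Q *\<^sub>v (s \<cdot>\<^sub>v w)))"
    using Q(1) r sw by (simp add: mult_add_distrib_mat_vec[OF Q(1) r sw] add_scalar_prod_distrib[of
        _ p] scalar_prod_add_distrib[of _ p])
  also have "\<dots> = scalar_prod r (Q *\<^sub>v r) + s * scalar_prod r (Q *\<^sub>v w) + (s * scalar_prod w (Q *\<^sub>v
      r) + s * (s * scalar_prod w (Q *\<^sub>v w)))"
    using Q(1) r w by (simp add: mult_mat_vec[OF Q(1) w])
  finally show ?thesis using sym by (simp add: power2_eq_square algebra_simps)
qed

lemma abs_scalar_prod_le:
  fixes r u :: rvec
  assumes "u \<in> carrier_vec p" "\<And>i. i < p \<Longrightarrow> \<bar>vec_index r i\<bar> \<le> L"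
  shows "\<bar>scalar_prod r u\<bar> \<le> L * (\<Sum>i<p. \<bar>vec_index u i\<bar>)"
proof -
  have "\<bar>scalar_prod r u\<bar> \<le> (\<Sum>i<p. \<bar>vec_index r i * vec_index u i\<bar>)"
    using assms(1) by (simp add: scalar_prod_def atLeast0LessThan sum_abs)
  also have "\<dots> \<le> (\<Sum>i<p. L * \<bar>vec_index u i\<bar>)"
    using assms(2) by (intro sum_mono) (auto simp: abs_mult intro!: mult_right_mono)
  finally show ?thesis by (simp add: sum_distrib_left)
qed

definition reg_obj :: "rmat \<Rightarrow> real \<Rightarrow> rvec \<Rightarrow> (rvec \<times> real) set \<Rightarrow> pre_state \<Rightarrow> rvec \<Rightarrow> ereal" where
  "reg_obj Q \<rho> r0 C S x = ereal (cost S x) + cut_max C (post S x) +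
     ereal (\<rho> / 2 * scalar_prod (post S x - r0) (Q *\<^sub>v (post S x - r0)))"

text \<open>Only the data are fixed; the previous resource state, the cuts and the incumbent vary.
  \<open>L\<close> will bound the coordinates of the difference from the incumbent.\<close>

locale stage_problem =
  fixes n m p :: nat and D :: stage_data and Q :: rmat and L :: real
  assumes A: "Amat D \<in> carrier_mat m n" and B: "Bmat D \<in> carrier_mat p n" and c: "cvec D \<in> carrier_vec n"
    and Q: "Q \<in> carrier_mat p p" "transpose_mat Q = Q" and L: "0 \<le> L"
begin

text \<open>Along \<open>d\<close> the unregularized objective falls at rate at least \<eta>, while
  the penalty rises to first order at rate at most \<open>\<rho> * K\<close>. If
  \<open>\<rho> * K < \<eta>\<close>, a short step improves. The step length may depend on the state
  but the threshold does not: hence the order of the quantifiers.\<close>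

lemma improving_not_minimal:
  assumes I: "I \<subseteq> {..<n}" and J: "finite J" "J \<subseteq> carrier_vec p \<times> UNIV" "J \<noteq> {}" and d:
      "improving n D I J d"
  shows "\<exists>\<delta>>0. \<forall>\<rho> S C x r0. 0 \<le> \<rho> \<longrightarrow> \<rho> < \<delta> \<longrightarrow> info S = D \<longrightarrow> finite C \<longrightarrow> C \<subseteq> carrier_vec p \<times> UNIV \<longrightarrow> C \<noteq> {} \<longrightarrow>
    x \<in> feasible n S \<longrightarrow> {i. i < n \<and> vec_index x i = 0} = I \<longrightarrow> active_cuts C (post S x) = J \<longrightarrow>
    r0 \<in> carrier_vec p \<longrightarrow> (\<forall>i<p. \<bar>vec_index (post S x - r0) i\<bar> \<le> L) \<longrightarrow>
    (\<exists>x'\<in>feasible n S. reg_obj Q \<rho> r0 C S x' < reg_obj Q \<rho> r0 C S x)"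
proof -
  have dc: "d \<in> carrier_vec n" and dA: "\<forall>r<m. vec_index (Amat D *\<^sub>v d) r = 0" and dI: "\<forall>i\<in>I. 0 \<le>
      vec_index d i"
    and dJ: "\<And>\<beta> \<gamma>. (\<beta>, \<gamma>) \<in> J \<Longrightarrow> scalar_prod (cvec D) d + scalar_prod \<beta> (Bmat D *\<^sub>v d) < 0"
    using d A by (auto simp: improving_def)
  define w where "w = Bmat D *\<^sub>v d"
  have w: "w \<in> carrier_vec p" using B dc by (simp add: w_def)
  define \<kappa> where "\<kappa> = scalar_prod (cvec D) d"
  \<comment> \<open>The slowest rate of decrease among the active cuts.\<close>
  define \<eta> where "\<eta> = Min ((\<lambda>(\<beta>, \<gamma>). - (\<kappa> + scalar_prod \<beta> w)) ` J)"
  have "0 < - (\<kappa> + scalar_prod \<beta> w)" if "(\<beta>, \<gamma>) \<in> J" for \<beta> \<gamma>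
    using dJ[OF that] by (simp add: \<kappa>_def w_def)
  then have "\<eta> > 0" unfolding \<eta>_def using J(1,3) by (subst Min_gr_iff) fast+
  have \<eta>J: "\<kappa> + scalar_prod \<beta> w \<le> - \<eta>" if "(\<beta>, \<gamma>) \<in> J" for \<beta> \<gamma>
  proof -
    have "\<eta> \<le> - (\<kappa> + scalar_prod \<beta> w)" unfolding \<eta>_def using J(1) that by (intro Min_le) force+
    then show ?thesis by simp
  qed
  define K where "K = L * (\<Sum>i<p. \<bar>vec_index (Q *\<^sub>v w) i\<bar>)"
  have "K \<ge> 0" unfolding K_def using L by (simp add: sum_nonneg)
  show ?thesis
  \<comment> \<open>Adding 1 covers the case \<open>K = 0\<close>.\<close>
  proof (rule exI[of _ "\<eta> / (K + 1)"], intro conjI allI impI)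
    show "0 < \<eta> / (K + 1)" using \<open>\<eta> > 0\<close> \<open>K \<ge> 0\<close> by simp
    fix \<rho> :: real and S C x r0
    assume \<rho>: "0 \<le> \<rho>" "\<rho> < \<eta> / (K + 1)" and S: "info S = D" and C: "finite C"
        "C \<subseteq> carrier_vec p \<times> UNIV" "C \<noteq> {}"
      and x: "x \<in> feasible n S" and xI: "{i. i < n \<and> vec_index x i = 0} = I" and xJ:
          "active_cuts C (post S x) = J"
      and r0: "r0 \<in> carrier_vec p" and bnd: "\<forall>i<p. \<bar>vec_index (post S x - r0) i\<bar> \<le> L"
    have AS: "Amat (info S) \<in> carrier_mat m n" using A S by simp
    have xc: "x \<in> carrier_vec n" and xpos: "\<And>i. i < n \<Longrightarrow> 0 \<le> vec_index x i"
      using x by (simp_all add: feasible_iff[OF AS])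
    define r where "r = post S x - r0"
    have Bx: "post S x \<in> carrier_vec p" using B xc S by (simp add: post_def)
    then have r: "r \<in> carrier_vec p" using r0 by (simp add: r_def)
    have rK: "scalar_prod r (Q *\<^sub>v w) \<le> K"
      using abs_scalar_prod_le[of "Q *\<^sub>v w" p r L] bnd Q w by (auto simp: K_def r_def)
    have "\<rho> * (K + 1) < \<eta>" using \<rho> \<open>K \<ge> 0\<close> by (simp add: pos_less_divide_eq)
    then have \<rho>K: "\<rho> * K < \<eta>" using \<rho> by (simp add: algebra_simps)
    obtain \<mu> where \<mu>: "cut_max C (post S x) = ereal \<mu>" "\<And>\<beta> \<gamma>. (\<beta>, \<gamma>) \<in> C \<Longrightarrow>
        scalar_prod \<beta> (post S x) + \<gamma> \<le> \<mu>"
      using cut_max_finite[OF C(1,3)] by metis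
    have Jiff: "(\<beta>, \<gamma>) \<in> J \<longleftrightarrow> (\<beta>, \<gamma>) \<in> C \<and> scalar_prod \<beta> (post S x) + \<gamma> = \<mu>" for \<beta> \<gamma>
      using xJ \<mu>(1) by (auto simp: active_cuts_def)
    \<comment> \<open>Three bounds on the step: positive coordinates stay nonnegative, no inactive
      cut spoils the guaranteed decrease \<open>s * \<eta>\<close>, and the second-order part of the
      penalty stays below the first-order gain.\<close>
    have "eventually (\<lambda>s. \<forall>i\<in>{..<n} - I. s * (- vec_index d i) < vec_index x i) (at_right 0)"
      using xpos xI by (intro eventually_ball_finite ballI eventually_at_right_mult_less) (auto
          simp: order_less_le)
    moreover have "eventually (\<lambda>s. \<forall>b\<in>C - J. s * (\<kappa> + scalar_prod (fst b) w + \<eta>) < \<mu> - (scalar_prod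
        (fst b) (post S x) + snd b)) (at_right 0)"
      using C(1) \<mu>(2) Jiff by (intro eventually_ball_finite ballI eventually_at_right_mult_less)
          (force simp: order_less_le)+
    moreover have "eventually (\<lambda>s. s * (\<rho> / 2 * scalar_prod w (Q *\<^sub>v w)) < \<eta> - \<rho> * K) (at_right 0)"
      using \<rho>K by (intro eventually_at_right_mult_less) simp
    moreover have "eventually (\<lambda>s. 0 < s) (at_right (0::real))" by (simp add: eventually_at_right_less)
    ultimately have "eventually (\<lambda>s. (\<forall>i\<in>{..<n} - I. s * (- vec_index d i) < vec_index x i) \<and>
        (\<forall>b\<in>C - J. s * (\<kappa> + scalar_prod (fst b) w + \<eta>) < \<mu> - (scalar_prod (fst b) (post S x) + snd b)) \<and>
        s * (\<rho> / 2 * scalar_prod w (Q *\<^sub>v w)) < \<eta> - \<rho> * K \<and> 0 < s) (at_right 0)"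
      by eventually_elim blast
    then obtain s where s1: "\<And>i. i < n \<Longrightarrow> i \<notin> I \<Longrightarrow> s * (- vec_index d i) < vec_index x i"
      and s2: "\<And>b. b \<in> C - J \<Longrightarrow> s * (\<kappa> + scalar_prod (fst b) w + \<eta>) < \<mu> - (scalar_prod (fst b) (post
          S x) + snd b)"
      and s3: "s * (\<rho> / 2 * scalar_prod w (Q *\<^sub>v w)) < \<eta> - \<rho> * K" and s: "0 < s"
      by (auto dest!: eventually_happens simp: trivial_limit_at_right_real)
    define x' where "x' = x + s \<cdot>\<^sub>v d"
    have sd: "s \<cdot>\<^sub>v d \<in> carrier_vec n" using dc by simp
    have "x' \<in> feasible n S" unfolding x'_def
    proof (rule feasible_add[OF AS x sd])
      show "\<forall>r<m. vec_index (Amat (info S) *\<^sub>v (s \<cdot>\<^sub>v d)) r = 0"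
        using dA A S by (simp add: mult_mat_vec[OF A dc])
      show "\<forall>i<n. 0 \<le> vec_index x i + vec_index (s \<cdot>\<^sub>v d) i"
      proof (intro allI impI)
        fix i assume i: "i < n"
        show "0 \<le> vec_index x i + vec_index (s \<cdot>\<^sub>v d) i"
        proof (cases "i \<in> I")
          case True
          then show ?thesis using xpos[OF i] dI s dc i by simp
        next
          case False
          then show ?thesis using s1[OF i False] dc i by simp
        qed
      qed
    qed
    moreover have "reg_obj Q \<rho> r0 C S x' < reg_obj Q \<rho> r0 C S x"
    proof -
      have post': "post S x' = post S x + s \<cdot>\<^sub>v w"
        using S by (simp add: post_def x'_def w_def mult_add_distrib_mat_vec[OF B xc sd]
            mult_mat_vec[OF B dc])
      have cost': "cost S x' = cost S x + s * \<kappa>"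
        using S c xc sd dc by (simp add: cost_def x'_def \<kappa>_def scalar_prod_add_distrib[of _ n])
      have diff': "post S x' - r0 = r + s \<cdot>\<^sub>v w"
        unfolding post' r_def using Bx r0 w by auto
      obtain \<mu>' where \<mu>': "cut_max C (post S x') = ereal \<mu>'" "\<exists>(\<beta>,
          \<gamma>)\<in>C. scalar_prod \<beta> (post S x') + \<gamma> = \<mu>'"
        using cut_max_finite[OF C(1,3)] by metis
      then obtain \<beta> \<gamma> where bg: "(\<beta>, \<gamma>) \<in> C" "scalar_prod \<beta> (post S x') + \<gamma> = \<mu>'" by blast
      have \<beta>: "\<beta> \<in> carrier_vec p" using C(2) bg by auto
      have \<mu>'_eq: "\<mu>' = scalar_prod \<beta> (post S x) + s * scalar_prod \<beta> w + \<gamma>"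
        using bg(2) unfolding post' using \<beta> Bx w by (simp add: scalar_prod_add_distrib[of _ p])
      have lin: "s * \<kappa> + \<mu>' \<le> \<mu> - s * \<eta>"
      proof (cases "(\<beta>, \<gamma>) \<in> J")
        case True
        then have "s * (\<kappa> + scalar_prod \<beta> w) \<le> s * (- \<eta>)" using \<eta>J s by (intro mult_left_mono) auto
        moreover have "scalar_prod \<beta> (post S x) + \<gamma> = \<mu>" using True Jiff by blast
        ultimately show ?thesis unfolding \<mu>'_eq by (simp add: algebra_simps)
      next
        case False
        then show ?thesis using s2[of "(\<beta>, \<gamma>)"] bg unfolding \<mu>'_eq by (simp add: algebra_simps)
      qed
      have "\<rho> * s * scalar_prod r (Q *\<^sub>v w) \<le> \<rho> * s * K" using rK \<rho> s by (intro mult_left_mono) auto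
      moreover have "s * (s * (\<rho> / 2 * scalar_prod w (Q *\<^sub>v w))) < s * (\<eta> - \<rho> * K)" using s3 s by simp
      ultimately have "cost S x' + \<mu>' + \<rho> / 2 * scalar_prod (post S x' - r0) (Q *\<^sub>v (post S x' - r0)) <
          cost S x + \<mu> + \<rho> / 2 * scalar_prod r (Q *\<^sub>v r)"
        unfolding diff' quadratic_form_add[OF Q r w] cost' using lin by (simp add:
            algebra_simps power2_eq_square)
      then show ?thesis unfolding reg_obj_def \<mu>(1) \<mu>'(1) r_def by simp
    qed
    ultimately show "\<exists>x'\<in>feasible n S. reg_obj Q \<rho> r0 C S x' < reg_obj Q \<rho> r0 C S x" by blast
  qed
qed

text \<open>Feasible points of one state differ by a kernel vector of \<open>Amat D\<close>, and
  where \<open>x\<close> vanishes \<open>x'\<close> is nonnegative. A cut active at \<open>x\<close>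
  equals the maximum there and is at most the maximum at \<open>x'\<close>, so along it the linear
  objective falls at least as much as the true one.\<close>

lemma improving_of_better_point:
  assumes S: "info S = D" and C: "finite C" "C \<subseteq> carrier_vec p \<times> UNIV" "C \<noteq> {}"
    and x: "x \<in> feasible n S" "x' \<in> feasible n S"
    and less: "ereal (cost S x') + cut_max C (post S x') < ereal (cost S x) + cut_max C (post S x)"
  shows "improving n D {i. i < n \<and> vec_index x i = 0} (active_cuts C (post S x)) (x' - x)"
proof -
  have AS: "Amat (info S) \<in> carrier_mat m n" using A S by simp
  have xc: "x \<in> carrier_vec n" "x' \<in> carrier_vec n" and x'pos: "\<And>i. i < n \<Longrightarrow> 0 \<le> vec_index x' i"
    using x by (simp_all add: feasible_iff[OF AS])
  have Bx: "post S x \<in> carrier_vec p" "post S x' \<in> carrier_vec p" using B xc S by (simp_all add: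
      post_def)
  obtain \<mu> where \<mu>: "cut_max C (post S x) = ereal \<mu>" using cut_max_finite[OF C(1,3)] by metis
  obtain \<mu>' where \<mu>': "cut_max C (post S x') = ereal \<mu>'" "\<And>\<beta> \<gamma>. (\<beta>, \<gamma>) \<in> C \<Longrightarrow>
      scalar_prod \<beta> (post S x') + \<gamma> \<le> \<mu>'"
    using cut_max_finite[OF C(1,3)] by metis
  have "scalar_prod (cvec D) (x' - x) + scalar_prod \<beta> (Bmat D *\<^sub>v (x' - x)) < 0"
    if "(\<beta>, \<gamma>) \<in> active_cuts C (post S x)" for \<beta> \<gamma>
  proof -
    have bC: "(\<beta>, \<gamma>) \<in> C" and act: "scalar_prod \<beta> (post S x) + \<gamma> = \<mu>" using that \<mu> by (auto simp:
        active_cuts_def)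
    then have \<beta>: "\<beta> \<in> carrier_vec p" using C by auto
    have "Bmat D *\<^sub>v (x' - x) = post S x' - post S x"
      using S by (simp add: post_def mult_minus_distrib_mat_vec[OF B xc(2,1)])
    then have "scalar_prod \<beta> (Bmat D *\<^sub>v (x' - x)) = scalar_prod \<beta> (post S x') - scalar_prod \<beta> (post
        S x)"
      using scalar_prod_minus_distrib[OF \<beta> Bx(2,1)] by simp
    moreover have "scalar_prod (cvec D) (x' - x) = cost S x' - cost S x"
      using S scalar_prod_minus_distrib[OF c xc(2,1)] by (simp add: cost_def)
    moreover have "cost S x' + \<mu>' < cost S x + \<mu>" using less \<mu> \<mu>' by simp
    ultimately show ?thesis using act \<mu>'(2)[OF bC] by simp
  qed
  then show ?thesis
    using feasible_diff[OF AS x] A S xc x'pos by (auto simp: improving_def)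
qed

text \<open>There are only finitely many pairs of zero coordinates and active cuts, and the improving
  direction of each of them rules out all small penalties.\<close>

lemma small_penalty_exact:
  assumes F: "finite F" "F \<subseteq> carrier_vec p \<times> UNIV"
  shows "\<exists>\<delta>>0. \<forall>\<rho> S C x r0. 0 \<le> \<rho> \<longrightarrow> \<rho> < \<delta> \<longrightarrow> info S = D \<longrightarrow> C \<subseteq> F \<longrightarrow> C \<noteq> {} \<longrightarrow>
    r0 \<in> carrier_vec p \<longrightarrow> (\<forall>i<p. \<bar>vec_index (post S x - r0) i\<bar> \<le> L) \<longrightarrow>
    x \<in> feasible n S \<longrightarrow> (\<forall>x'\<in>feasible n S. reg_obj Q \<rho> r0 C S x \<le> reg_obj Q \<rho> r0 C S x') \<longrightarrow>
    (\<forall>x'\<in>feasible n S. ereal (cost S x) + cut_max C (post S x) \<le>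
        ereal (cost S x') + cut_max C (post S x'))"
proof -
  define excl where "excl I J \<delta> \<longleftrightarrow> (\<forall>\<rho> S C x r0. 0 \<le> \<rho> \<longrightarrow> \<rho> < \<delta> \<longrightarrow> info S = D \<longrightarrow> finite C \<longrightarrow>
      C \<subseteq> carrier_vec p \<times> UNIV \<longrightarrow> C \<noteq> {} \<longrightarrow>
    x \<in> feasible n S \<longrightarrow> {i. i < n \<and> vec_index x i = 0} = I \<longrightarrow> active_cuts C (post S x) = J \<longrightarrow>
    r0 \<in> carrier_vec p \<longrightarrow> (\<forall>i<p. \<bar>vec_index (post S x - r0) i\<bar> \<le> L) \<longrightarrow>
    (\<exists>x'\<in>feasible n S. reg_obj Q \<rho> r0 C S x' < reg_obj Q \<rho> r0 C S x))" for I J and \<delta> :: real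
  define types where "types = Pow {..<n} \<times> (Pow F - {{}})"
  have fin: "finite types" using F(1) by (simp add: types_def)
  have "\<exists>\<delta>>0. (\<exists>d. improving n D I J d) \<longrightarrow> excl I J \<delta>" if "(I, J) \<in> types" for I J
  proof (cases "\<exists>d. improving n D I J d")
    case True
    then obtain d where d: "improving n D I J d" by blast
    have IJ: "I \<subseteq> {..<n}" "finite J" "J \<subseteq> carrier_vec p \<times> UNIV" "J \<noteq> {}"
      using that F finite_subset by (auto simp: types_def)
    then show ?thesis using improving_not_minimal[OF IJ d] unfolding excl_def by blast
  next
    case False
    then show ?thesis by (intro exI[of _ 1]) simp
  qed
  then obtain \<delta> where \<delta>: "\<And>I J. (I, J) \<in> types \<Longrightarrow> \<delta> I J > 0 \<and> ((\<exists>d. improving n D I J d) \<longrightarrow>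
      excl I J (\<delta> I J))"
    by metis
  \<comment> \<open>Inserting 1 covers an empty \<open>F\<close>, for which there are no
    patterns.\<close>
  define \<delta>0 where "\<delta>0 = Min (insert 1 ((\<lambda>(I, J). \<delta> I J) ` types))"
  have "\<delta>0 > 0" unfolding \<delta>0_def using fin \<delta> by (subst Min_gr_iff) auto
  have \<delta>0_le: "\<delta>0 \<le> \<delta> I J" if "(I, J) \<in> types" for I J
    unfolding \<delta>0_def using fin that by (intro Min_le) force+
  show ?thesis
  proof (rule exI[of _ \<delta>0], intro conjI allI impI ballI, fact)
    fix \<rho> :: real and S C x r0 x'
    assume \<rho>: "0 \<le> \<rho>" "\<rho> < \<delta>0" and S: "info S = D" and C: "C \<subseteq> F" "C \<noteq> {}" and r0: "r0 \<in> carrier_vec p"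
      and bnd: "\<forall>i<p. \<bar>vec_index (post S x - r0) i\<bar> \<le> L" and x: "x \<in> feasible n S"
      and min: "\<forall>x'\<in>feasible n S. reg_obj Q \<rho> r0 C S x \<le> reg_obj Q \<rho> r0 C S x'" and x':
          "x' \<in> feasible n S"
    have C': "finite C" "C \<subseteq> carrier_vec p \<times> UNIV" using C(1) F finite_subset by auto
    show "ereal (cost S x) + cut_max C (post S x) \<le> ereal (cost S x') + cut_max C (post S x')"
    proof (rule ccontr)
      \<comment> \<open>The direction \<open>x' - x\<close> depends on the state and is not the one
        used for descent. It only shows that the pattern of \<open>x\<close> has an improving
        direction, and the threshold of each such pattern comes from one fixed choice.\<close>
      assume "\<not> ?thesis"
      then have imp: "improving n D {i. i < n \<and> vec_index x i = 0} (active_cuts C (post S x)) (x' - x)"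
        (is "improving n D ?I ?J _")
        using improving_of_better_point[OF S C' C(2) x x'] by simp
      obtain \<mu> where "cut_max C (post S x) = ereal \<mu>" "\<exists>(\<beta>, \<gamma>)\<in>C. scalar_prod \<beta> (post S x) + \<gamma> = \<mu>"
        using cut_max_finite[OF C'(1) C(2)] by metis
      then have "?J \<noteq> {}" by (force simp: active_cuts_def)
      then have "(?I, ?J) \<in> types" using C(1) by (auto simp: types_def active_cuts_def)
      then have "excl ?I ?J (\<delta> ?I ?J)" "\<rho> < \<delta> ?I ?J" using \<delta> imp \<delta>0_le \<rho>(2) by (blast, force)
      then obtain y where "y \<in> feasible n S" "reg_obj Q \<rho> r0 C S y < reg_obj Q \<rho> r0 C S x"
        using \<rho>(1) S C' C(2) x r0 bnd unfolding excl_def by blast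
      then show False using min by (simp add: not_less[symmetric])
    qed
  qed
qed

end

section \<open>Uniform bounds on feasible decisions\<close>

text \<open>Bolzano-Weierstrass in the cube, one coordinate at a time: the subsequence found for the
  first \<open>d\<close> coordinates is refined.\<close>

lemma coordinatewise_convergent_subsequence:
  fixes X :: "nat \<Rightarrow> nat \<Rightarrow> real"
  assumes "\<And>k i. i < d \<Longrightarrow> X k i \<in> {0..1}"
  shows "\<exists>r u. strict_mono r \<and> (\<forall>i<d. (\<lambda>k. X (r k) i) \<longlonglongrightarrow> u i)"
  using assms
proof (induction d)
  case 0
  then show ?case by (auto intro: exI[of _ id] simp: strict_mono_def)
next
  case (Suc d)
  then obtain r u where r: "strict_mono r" "\<forall>i<d. (\<lambda>k. X (r k) i) \<longlonglongrightarrow> u i" by force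
  have "seq_compact {0..1::real}" by (simp add: compact_imp_seq_compact)
  then obtain l q where q: "strict_mono q" "((\<lambda>k. X (r k) d) \<circ> q) \<longlonglongrightarrow> l"
    by (rule seq_compactE[of _ "\<lambda>k. X (r k) d"]) (use Suc.prems in auto)
  have "(\<lambda>k. X ((r \<circ> q) k) i) \<longlonglongrightarrow> (u(d := l)) i" if "i < Suc d" for i
  proof (cases "i = d")
    case True
    then show ?thesis using q(2) by (simp add: o_def)
  next
    case False
    then show ?thesis using LIMSEQ_subseq_LIMSEQ[OF r(2)[rule_format, of i] q(1)] that by (simp add:
        o_def)
  qed
  moreover have "strict_mono (r \<circ> q)" using r(1) q(1) by (rule strict_mono_o)
  ultimately show ?case by blast
qed

lemma bounded_vecs_index_le:
  assumes "bounded_vecs X" "X \<subseteq> carrier_vec n"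
  obtains K where "\<And>x i. x \<in> X \<Longrightarrow> i < n \<Longrightarrow> \<bar>vec_index x i\<bar> \<le> K"
proof -
  obtain K where K: "\<And>x. x \<in> X \<Longrightarrow> sqrt (scalar_prod x x) \<le> K" using assms(1) by (auto simp:
      bounded_vecs_def)
  have "\<bar>vec_index x i\<bar> \<le> K" if x: "x \<in> X" and i: "i < n" for x i
  proof -
    have "dim_vec x = n" using x assms(2) by auto
    then have "(vec_index x i)\<^sup>2 \<le> scalar_prod x x"
      unfolding scalar_prod_def power2_eq_square using i
      by (intro member_le_sum[of i "{0..<dim_vec x}" "\<lambda>i. vec_index x i * vec_index x i"]) auto
    then have "\<bar>vec_index x i\<bar> \<le> sqrt (scalar_prod x x)"
        by (rule real_le_rsqrt[of "\<bar>vec_index x i\<bar>", simplified])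
    then show ?thesis using K[OF x] by simp
  qed
  then show ?thesis using that by blast
qed

text \<open>Boundedness of one nonempty feasible set forces the recession cone \<open>{u \<ge> 0. A u = 0}\<close> to be
  trivial, and this bounds the feasible sets of all right-hand sides of bounded size.\<close>

lemma feasible_uniformly_bounded:
  assumes A: "Amat D \<in> carrier_mat m n" and S: "info S = D" "feasible n S \<noteq> {}"
      "bounded_vecs (feasible n S)"
  shows "\<exists>K. \<forall>x\<in>carrier_vec n. (\<forall>i<n. 0 \<le> vec_index x i) \<longrightarrow> (\<forall>r<m. \<bar>vec_index (Amat D *\<^sub>v x) r\<bar> \<le> L) \<longrightarrow>
    (\<forall>i<n. vec_index x i \<le> K)"
proof (rule ccontr)
  assume "\<not> ?thesis"
  then have "\<forall>k::nat. \<exists>x. x \<in> carrier_vec n \<and> (\<forall>i<n. 0 \<le> vec_index x i) \<and>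
      (\<forall>r<m. \<bar>vec_index (Amat D *\<^sub>v x) r\<bar> \<le> L) \<and> (\<exists>i<n. real k < vec_index x i)"
    by (meson not_le)
  then obtain x where x: "\<And>k. x k \<in> carrier_vec n" and pos: "\<And>k i. i < n \<Longrightarrow> 0 \<le> vec_index (x k) i"
    and Ax: "\<And>k r. r < m \<Longrightarrow> \<bar>vec_index (Amat D *\<^sub>v x k) r\<bar> \<le> L" and big:
        "\<And>k. \<exists>i<n. real k < vec_index (x k) i"
    by metis
  \<comment> \<open>Dividing by the coordinate sum places the points on the unit simplex, so the
    limit direction cannot vanish.\<close>
  define s where "s k = (\<Sum>i<n. vec_index (x k) i)" for k
  have s_ge: "vec_index (x k) i \<le> s k" if "i < n" for k i
    unfolding s_def using that pos by (intro member_le_sum) auto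
  have s_big: "real k < s k" for k using big[of k] s_ge by (meson less_le_trans)
  then have s_pos: "0 < s k" for k by (meson le_less_trans of_nat_0_le_iff)
  define X where "X k i = vec_index (x k) i / s k" for k i
  have "X k i \<in> {0..1}" if "i < n" for k i
    using pos[OF that, of k] s_ge[OF that, of k] s_pos[of k] by (simp add: X_def)
  then obtain r u where r: "strict_mono r" and u: "\<And>i. i < n \<Longrightarrow> (\<lambda>k. X (r k) i) \<longlonglongrightarrow> u i"
    using coordinatewise_convergent_subsequence[of n X] by blast
  have u_nonneg: "0 \<le> u i" if "i < n" for i
    using u[OF that] pos[OF that] s_pos by (rule_tac LIMSEQ_le_const) (auto simp: X_def less_imp_le)
  have "(\<Sum>i<n. X k i) = 1" for k
    unfolding X_def sum_divide_distrib[symmetric] using s_pos[of k] by (simp add: s_def)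
  moreover have "(\<lambda>k. \<Sum>i<n. X (r k) i) \<longlonglongrightarrow> (\<Sum>i<n. u i)" by (intro tendsto_sum) (use u in auto)
  ultimately have "(\<Sum>i<n. u i) = 1" by (simp add: LIMSEQ_const_iff)
  then have "\<exists>i<n. u i \<noteq> 0" by (metis lessThan_iff sum.neutral zero_neq_one)
  then obtain j where j: "j < n" "0 < u j" using u_nonneg by (metis order_less_le)
  define d where "d = Matrix.vec n u"
  have Ad: "vec_index (Amat D *\<^sub>v d) q = 0" if q: "q < m" for q
  proof -
    have "(\<lambda>k. \<Sum>i<n. Amat D $$ (q, i) * X (r k) i) \<longlonglongrightarrow> (\<Sum>i<n. Amat D $$ (q, i) * u i)"
      by (intro tendsto_intros) (use u in auto)
    \<comment> \<open>The right-hand sides are bounded while the coordinate sums tend to infinity,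
      also along the subsequence.\<close>
    moreover have "(\<lambda>k. \<Sum>i<n. Amat D $$ (q, i) * X (r k) i) \<longlonglongrightarrow> 0"
    proof (rule Lim_null_comparison)
      show "eventually (\<lambda>k. norm (\<Sum>i<n. Amat D $$ (q, i) * X (r k) i) \<le>
          L * inverse (real k)) sequentially"
      proof (rule eventually_sequentiallyI[of 1])
        fix k :: nat assume k: "1 \<le> k"
        have "(\<Sum>i<n. Amat D $$ (q, i) * X (r k) i) = vec_index (Amat D *\<^sub>v x (r k)) q / s (r k)"
          using A q x[of "r k"] by (simp add: X_def scalar_prod_def sum_divide_distrib atLeast0LessThan)
        then have "norm (\<Sum>i<n. Amat D $$ (q, i) * X (r k) i) =
            \<bar>vec_index (Amat D *\<^sub>v x (r k)) q\<bar> / s (r k)"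
          using s_pos[of "r k"] by simp
        also have "\<dots> \<le> L / s (r k)" using Ax[OF q, of "r k"] s_pos[of "r k"] by (simp add:
            divide_right_mono)
        also have "\<dots> \<le> L / real k"
        proof (rule divide_left_mono)
          show "real k \<le> s (r k)" using s_big[of "r k"] seq_suble[OF r, of k] by linarith
          show "0 \<le> L" using Ax[OF q, of 0] by simp
        qed (use k s_pos[of "r k"] in simp)
        finally show "norm (\<Sum>i<n. Amat D $$ (q, i) * X (r k) i) \<le> L * inverse (real k)"
          by (simp add: divide_inverse)
      qed
      show "(\<lambda>k. L * inverse (real k)) \<longlonglongrightarrow> 0"
        using tendsto_mult_left[OF lim_inverse_n, of L] by simp
    qed
    ultimately have "(\<Sum>i<n. Amat D $$ (q, i) * u i) = 0" by (rule LIMSEQ_unique)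
    then show ?thesis using A q by (simp add: d_def scalar_prod_def atLeast0LessThan)
  qed
  have AS: "Amat (info S) \<in> carrier_mat m n" using A S by simp
  obtain x0 where x0: "x0 \<in> feasible n S" using S(2) by blast
  have x0c: "x0 \<in> carrier_vec n" "\<And>i. i < n \<Longrightarrow> 0 \<le> vec_index x0 i" using x0 by (simp_all add:
      feasible_iff[OF AS])
  have dc: "d \<in> carrier_vec n" by (simp add: d_def)
  have sub: "feasible n S \<subseteq> carrier_vec n" by (auto simp: feasible_iff[OF AS])
  obtain K where K: "\<And>x i. x \<in> feasible n S \<Longrightarrow> i < n \<Longrightarrow> \<bar>vec_index x i\<bar> \<le> K"
    using bounded_vecs_index_le[OF S(3) sub] by blast
  \<comment> \<open>Chosen so that coordinate \<open>j\<close> of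
    \<open>x0 + c \<cdot>\<^sub>v d\<close> is at least \<open>K + 1\<close>, against the bound
    \<open>K\<close>.\<close>
  define c where "c = (K + 1) / u j"
  have "0 \<le> K" using K[OF x0 j(1)] by simp
  then have c0: "0 \<le> c" using j by (simp add: c_def)
  have "x0 + c \<cdot>\<^sub>v d \<in> feasible n S"
  proof (rule feasible_add[OF AS x0])
    show "c \<cdot>\<^sub>v d \<in> carrier_vec n" using dc by simp
    show "\<forall>r<m. vec_index (Amat (info S) *\<^sub>v (c \<cdot>\<^sub>v d)) r = 0"
      using Ad A S by (simp add: mult_mat_vec[OF A dc])
    show "\<forall>i<n. 0 \<le> vec_index x0 i + vec_index (c \<cdot>\<^sub>v d) i"
      using x0c c0 u_nonneg by (simp add: d_def)
  qed
  from K[OF this j(1)] have "vec_index x0 j + c * u j \<le> K" using j(1) dc x0c by (simp add: d_def)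
  moreover have "c * u j = K + 1" using j by (simp add: c_def)
  ultimately show False using x0c(2)[OF j(1)] by simp
qed

lemma finite_uniform_bound:
  fixes P :: "'a \<Rightarrow> real \<Rightarrow> bool"
  assumes "finite X" "\<And>x. x \<in> X \<Longrightarrow> \<exists>K. P x K" "\<And>x K K'. P x K \<Longrightarrow> K \<le> K' \<Longrightarrow> P x K'"
  shows "\<exists>K\<ge>0. \<forall>x\<in>X. P x K"
  using assms(1,2)
proof (induction X rule: finite_induct)
  case (insert x X)
  then obtain K K' where "0 \<le> K" "\<forall>x\<in>X. P x K" "P x K'" by blast
  then have "\<forall>y\<in>insert x X. P y (max K K')" "0 \<le> max K K'" using assms(3) by (auto intro:
      max.cobounded1 max.cobounded2)
  then show ?case by blast
qed auto

context qrm
begin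

section \<open>Bounds along all feasible trajectories\<close>

lemma finite_scenarios: "finite (scenarios pr)"
proof -
  have "finite (Pi\<^sub>E {1..T} (outcomes pr))" using finite_outcomes by (intro finite_PiE) auto
  then show ?thesis using wf unfolding wf_mslp_def by (meson finite_subset)
qed

lemma feasible_upto_mono: "feasible_upto pr v y t \<Longrightarrow> s \<le> t \<Longrightarrow> feasible_upto pr v y s"
  by (simp add: feasible_upto_def)

lemma info_state_along: "info (state_along pr y v t) = data_along pr v t"
  by (simp add: state_along_def data_along_def)

lemma post_state_bounded:
  assumes "t \<le> T"
    and "\<exists>L\<ge>0. \<forall>v\<in>scenarios pr. \<forall>y. feasible_upto pr v y t \<longrightarrow> (\<forall>i<xdim pr t. \<bar>vec_index (y t) i\<bar> \<le> L)"
  shows "\<exists>L\<ge>0. \<forall>v\<in>scenarios pr. \<forall>y. feasible_upto pr v y t \<longrightarrow>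
    (\<forall>r<rdim pr (Suc t). \<bar>vec_index (Bmat (data_along pr v t) *\<^sub>v y t) r\<bar> \<le> L)"
proof (rule finite_uniform_bound[OF finite_scenarios])
  fix v assume v: "v \<in> scenarios pr"
  obtain L where L: "0 \<le> L" "\<And>y i. feasible_upto pr v y t \<Longrightarrow> i < xdim pr t \<Longrightarrow> \<bar>vec_index (y t) i\<bar> \<le> L"
    using assms(2) v by blast
  define B where "B = Bmat (data_along pr v t)"
  have A: "Amat (data_along pr v t) \<in> carrier_mat (rdim pr t) (xdim pr t)"
    and B: "B \<in> carrier_mat (rdim pr (Suc t)) (xdim pr t)"
    using wf_data_along[OF v assms(1)] by (auto simp: wf_stage_def B_def)
  define K where "K = (\<Sum>r<rdim pr (Suc t). L * (\<Sum>i<xdim pr t. \<bar>vec_index (Matrix.row B r) i\<bar>))"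
  have "\<bar>vec_index (B *\<^sub>v y t) r\<bar> \<le> K" if y: "feasible_upto pr v y t" and r: "r < rdim pr (Suc t)"
      for y r
  proof -
    have "y t \<in> feasible (xdim pr t) (state_along pr y v t)" using y by (simp add: feasible_upto_def)
    then have yc: "y t \<in> carrier_vec (xdim pr t)"
      using A by (simp add: feasible_iff[where m="rdim pr t"] info_state_along)
    have rc: "Matrix.row B r \<in> carrier_vec (xdim pr t)" using B r by simp
    have "vec_index (B *\<^sub>v y t) r = scalar_prod (y t) (Matrix.row B r)"
      using B r comm_scalar_prod[OF yc rc] by simp
    then have "\<bar>vec_index (B *\<^sub>v y t) r\<bar> \<le> L * (\<Sum>i<xdim pr t. \<bar>vec_index (Matrix.row B r) i\<bar>)"
      using abs_scalar_prod_le[OF rc, of "y t" L] L(2)[OF y] by simp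
    also have "\<dots> \<le> K" unfolding K_def using r L(1)
      by (intro member_le_sum[of r "{..<rdim pr (Suc t)}"
          "\<lambda>r. L * (\<Sum>i<xdim pr t. \<bar>vec_index (Matrix.row B r) i\<bar>)"])
        (auto intro!: mult_nonneg_nonneg sum_nonneg)
    finally show ?thesis .
  qed
  then show "\<exists>L. \<forall>y. feasible_upto pr v y t \<longrightarrow>
    (\<forall>r<rdim pr (Suc t). \<bar>vec_index (Bmat (data_along pr v t) *\<^sub>v y t) r\<bar> \<le> L)"
    unfolding B_def by blast
qed (meson order_trans)

text \<open>The boundedness hypothesis treats each feasible set separately. By induction the
  previous resource states are bounded, hence so are the right-hand sides, and one bounded feasible
  set, nonempty by recourse, then yields a bound common to all of them.\<close>

lemma decisions_bounded:
  assumes "t \<le> T"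
  shows "\<exists>L\<ge>0. \<forall>v\<in>scenarios pr. \<forall>y. feasible_upto pr v y t \<longrightarrow> (\<forall>i<xdim pr t. \<bar>vec_index (y t) i\<bar> \<le> L)"
  using assms
proof (induction t)
  case 0
  have A: "Amat (data0 pr) \<in> carrier_mat (rdim pr 0) (xdim pr 0)" using wf by (simp add:
      wf_mslp_def wf_stage_def)
  have "bounded_vecs (feasible (xdim pr 0) (Init (data0 pr)))" using bounded by (simp add:
      bounded_feasible_sets_def)
  moreover have "feasible (xdim pr 0) (Init (data0 pr)) \<subseteq> carrier_vec (xdim pr 0)" by auto
  ultimately obtain K where K: "\<And>x i. x \<in> feasible (xdim pr 0) (Init (data0 pr)) \<Longrightarrow> i < xdim pr 0 \<Longrightarrow>
      \<bar>vec_index x i\<bar> \<le> K"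
    using bounded_vecs_index_le by blast
  have "\<bar>vec_index (y 0) i\<bar> \<le> max K 0" if "feasible_upto pr v y 0" "i < xdim pr 0" for v y i
    using that K[of "y 0" i] by (auto simp: feasible_upto_def state_along_def simp del: feasible.simps)
  then show ?case by (intro exI[of _ "max K 0"]) auto
next
  case (Suc t)
  then have "t \<le> T" by simp
  from post_state_bounded[OF this Suc.IH[OF this]]
  obtain L where L: "0 \<le> L" "\<And>v y r. v \<in> scenarios pr \<Longrightarrow> feasible_upto pr v y t \<Longrightarrow> r < rdim pr (Suc t) \<Longrightarrow>
      \<bar>vec_index (Bmat (data_along pr v t) *\<^sub>v y t) r\<bar> \<le> L"
    by blast
  show ?case
  proof (rule finite_uniform_bound[OF finite_scenarios])
    fix v assume v: "v \<in> scenarios pr"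
    define D where "D = data pr (Suc t) (v (Suc t))"
    have a: "v (Suc t) \<in> outcomes pr (Suc t)" using scenario_outcome[OF v] Suc.prems by simp
    have wfD: "wf_stage pr (Suc t) D" using wf_data[OF _ Suc.prems a] by (simp add: D_def)
    then have A: "Amat D \<in> carrier_mat (rdim pr (Suc t)) (xdim pr (Suc t))" and b:
        "bvec D \<in> carrier_vec (rdim pr (Suc t))"
      by (auto simp: wf_stage_def)
    show "\<exists>L. \<forall>y. feasible_upto pr v y (Suc t) \<longrightarrow> (\<forall>i<xdim pr (Suc t). \<bar>vec_index (y (Suc t)) i\<bar> \<le> L)"
    proof (cases "\<exists>y. feasible_upto pr v y t")
      case False
      then show ?thesis using feasible_upto_mono[of v _ "Suc t" t] by auto
    next
      case True
      then obtain y0 where y0: "feasible_upto pr v y0 t" by blast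
      \<comment> \<open>The updated scenario is \<open>v\<close> itself, written in the form of the
        recourse and boundedness hypotheses.\<close>
      define S where "S = state_along pr y0 (v(Suc t := v (Suc t))) (Suc t)"
      have t: "t < T" using Suc.prems by simp
      have S1: "feasible (xdim pr (Suc t)) S \<noteq> {}"
        using recourse v y0 t a unfolding relatively_complete_recourse_def S_def by blast
      have S2: "bounded_vecs (feasible (xdim pr (Suc t)) S)"
        using bounded v y0 t a unfolding bounded_feasible_sets_def S_def by blast
      have S3: "info S = D" by (simp add: S_def state_along_def D_def)
      obtain K where K: "\<And>x i. x \<in> carrier_vec (xdim pr (Suc t)) \<Longrightarrow> (\<forall>i<xdim pr (Suc t). 0 \<le>
          vec_index x i) \<Longrightarrow>
          (\<forall>r<rdim pr (Suc t). \<bar>vec_index (Amat D *\<^sub>v x) r\<bar> \<le>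
              (\<Sum>r<rdim pr (Suc t). \<bar>vec_index (bvec D) r\<bar>) + L) \<Longrightarrow>
          i < xdim pr (Suc t) \<Longrightarrow> vec_index x i \<le> K"
        using feasible_uniformly_bounded[OF A S3 S1 S2, of "(\<Sum>r<rdim pr (Suc t). \<bar>vec_index (bvec D)
            r\<bar>) + L"]
        by blast
      have "\<bar>vec_index (y (Suc t)) i\<bar> \<le> K" if y: "feasible_upto pr v y (Suc t)" and i:
          "i < xdim pr (Suc t)" for y i
      proof -
        let ?R = "Bmat (data_along pr v t) *\<^sub>v y t"
        have AS: "Amat (info (state_along pr y v (Suc t))) \<in> carrier_mat (rdim pr (Suc t)) (xdim pr
            (Suc t))"
          using A by (simp add: state_along_def D_def)
        have "y (Suc t) \<in> feasible (xdim pr (Suc t)) (state_along pr y v (Suc t))"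
          using y by (simp add: feasible_upto_def)
        then have yc: "y (Suc t) \<in> carrier_vec (xdim pr (Suc t))" "\<forall>i<xdim pr (Suc t). 0 \<le>
            vec_index (y (Suc t)) i"
          and eq: "\<And>r. r < rdim pr (Suc t) \<Longrightarrow> vec_index (Amat D *\<^sub>v y (Suc t)) r =
              vec_index (bvec D) r - vec_index ?R r"
          unfolding feasible_iff[OF AS] by (auto simp: state_along_def D_def)
        have "\<bar>vec_index (Amat D *\<^sub>v y (Suc t)) r\<bar> \<le> (\<Sum>r<rdim pr (Suc t). \<bar>vec_index (bvec D) r\<bar>) + L"
          if r: "r < rdim pr (Suc t)" for r
        proof -
          have "\<bar>vec_index (bvec D) r\<bar> \<le> (\<Sum>r<rdim pr (Suc t). \<bar>vec_index (bvec D) r\<bar>)"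
            using r by (intro member_le_sum[of r "{..<rdim pr (Suc t)}"
                "\<lambda>r. \<bar>vec_index (bvec D) r\<bar>"]) auto
          moreover have "\<bar>vec_index ?R r\<bar> \<le> L" using L(2)[OF v feasible_upto_mono[OF y] r] by simp
          ultimately show ?thesis unfolding eq[OF r] by linarith
        qed
        then show ?thesis using K[OF yc _ i] yc(2) i by simp
      qed
      then show ?thesis by blast
    qed
  qed (meson order_trans)
qed

lemma post_decision_states_bounded:
  "\<exists>L\<ge>0. \<forall>t\<le>T. \<forall>v\<in>scenarios pr. \<forall>y. feasible_upto pr v y t \<longrightarrow>
    (\<forall>r<rdim pr (Suc t). \<bar>vec_index (Bmat (data_along pr v t) *\<^sub>v y t) r\<bar> \<le> L)"
proof -
  have "\<exists>L\<ge>0. \<forall>t\<in>{..T}. \<forall>v\<in>scenarios pr. \<forall>y. feasible_upto pr v y t \<longrightarrow>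
    (\<forall>r<rdim pr (Suc t). \<bar>vec_index (Bmat (data_along pr v t) *\<^sub>v y t) r\<bar> \<le> L)"
  proof (rule finite_uniform_bound[OF finite_atMost])
    fix t assume "t \<in> {..T}"
    then have "t \<le> T" by simp
    then show "\<exists>L. \<forall>v\<in>scenarios pr. \<forall>y. feasible_upto pr v y t \<longrightarrow>
        (\<forall>r<rdim pr (Suc t). \<bar>vec_index (Bmat (data_along pr v t) *\<^sub>v y t) r\<bar> \<le> L)"
      using post_state_bounded[OF _ decisions_bounded, of t] by blast
  qed (meson order_trans)
  then show ?thesis by auto
qed

end

section \<open>Tight approximations and convergence\<close>

lemma finite_uniform_threshold:
  fixes P :: "'a \<Rightarrow> real \<Rightarrow> bool"
  assumes "finite X" "\<And>x. x \<in> X \<Longrightarrow> \<exists>\<delta>>0. P x \<delta>" "\<And>x \<delta> \<delta>'. P x \<delta> \<Longrightarrow> \<delta>' \<le> \<delta> \<Longrightarrow> P x \<delta>'"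
  shows "\<exists>\<delta>>0. \<forall>x\<in>X. P x \<delta>"
  using assms(1,2)
proof (induction X rule: finite_induct)
  case empty
  then show ?case by (auto intro: exI[of _ 1])
next
  case (insert x X)
  then obtain K K' where K: "0 < K" "\<forall>x\<in>X. P x K" "0 < K'" "P x K'" by (metis insert_iff)
  then have "\<forall>y\<in>insert x X. P y (min K K')" "0 < min K K'" using assms(3) by (auto intro:
      min.cobounded1 min.cobounded2)
  then show ?case by blast
qed

context qrm
begin

section \<open>Exactness of the regularized forward pass\<close>

definition forward_post :: "'w iteration list \<Rightarrow> (nat \<Rightarrow> 'w) \<Rightarrow> nat \<Rightarrow> rvec" where
  "forward_post h v t = Bmat (data_along pr v t) *\<^sub>v forward_dec sel h v t"

lemma forward_post_eq: "post (forward_state pr sel h v t) (forward_dec sel h v t) = forward_post h v t"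
  by (simp add: forward_post_def post_def forward_state_def info_state_along)

lemma forward_post_carrier:
  "v \<in> scenarios pr \<Longrightarrow> t \<le> T \<Longrightarrow> forward_post h v t \<in> carrier_vec (rdim pr (Suc t))"
  using wf_data_along[of v t] by (auto simp: forward_post_def wf_stage_def intro!: carrier_vecI)

lemma forward_feasible:
  assumes "forward_ok pr Q \<rho> sel h it" "v \<in> scenarios pr" "t \<le> T"
  shows "forward_dec sel h v t \<in> feasible (xdim pr t) (forward_state pr sel h v t)"
  using assms by (auto simp: forward_ok_def is_arg_min_def)

lemma forward_feasible_upto:
  assumes "forward_ok pr Q \<rho> sel h it" "v \<in> scenarios pr" "t \<le> T"
  shows "feasible_upto pr v (forward_dec sel h v) t"
  using forward_feasible[OF assms(1,2)] assms(3) by (simp add: feasible_upto_def forward_state_def)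

lemma trial_point_eq:
  assumes "forward_ok pr Q \<rho> sel h it" "t \<le> T"
  shows "trial_point pr it t = forward_post h (scen it) t"
  using assms by (simp add: trial_point_def forward_post_def forward_ok_def)

lemma cut_set_carrier: "cut_set pr h t \<subseteq> carrier_vec (rdim pr (Suc t)) \<times> UNIV"
  by (induction h) (auto simp: cut_set_Cons new_cut_def cut_slope_carrier)

text \<open>The threshold is uniform over histories: all cuts at time \<open>t\<close> come from one
  finite set, and all resource states that can be visited are bounded. \<open>h \<noteq> []\<close>
  provides an incumbent and at least one cut. The penalty index \<open>length h\<close> is the
  number of the iteration that starts from \<open>h\<close>.\<close>

lemma forward_exact_at:
  assumes v: "v \<in> scenarios pr" and t: "t < T"
  shows "\<exists>\<delta>>0. \<forall>h it. valid (it # h) \<longrightarrow> h \<noteq> [] \<longrightarrow> \<rho> (length h) < \<delta> \<longrightarrow>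
    stage_value pr t (Vbar pr h t) (forward_state pr sel h v t) =
      ereal (cost (forward_state pr sel h v t) (forward_dec sel h v t)) + Vbar pr h t (forward_post
          h v t)"
proof -
  let ?p = "rdim pr (Suc t)" and ?n = "xdim pr t"
  define D where "D = data_along pr v t"
  have D: "Amat D \<in> carrier_mat (rdim pr t) ?n" "Bmat D \<in> carrier_mat ?p ?n" "cvec D \<in> carrier_vec ?n"
    using wf_data_along[OF v] t by (auto simp: wf_stage_def D_def)
  have Qt: "Q t \<in> carrier_mat ?p ?p" "transpose_mat (Q t) = Q t" using psd t by (auto simp: psd_mat_def)
  obtain L where L: "0 \<le> L" "\<And>v y r. v \<in> scenarios pr \<Longrightarrow> feasible_upto pr v y t \<Longrightarrow> r < ?p \<Longrightarrow>
      \<bar>vec_index (Bmat (data_along pr v t) *\<^sub>v y t) r\<bar> \<le> L"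
    using post_decision_states_bounded t by (meson less_imp_le)
  \<comment> \<open>The bound is \<open>2 * L\<close> because both the new resource state and the
    incumbent are bounded by \<open>L\<close>.\<close>
  interpret sp: stage_problem ?n "rdim pr t" ?p D "Q t" "2 * L"
    by unfold_locales (use D Qt L in auto)
  obtain F where F: "finite F" "\<And>h. valid h \<Longrightarrow> cut_set pr h t \<subseteq> F"
    using finitely_many_cuts[of t] t by (meson less_imp_le)
  define F' where "F' = F \<inter> carrier_vec ?p \<times> UNIV"
  have "finite F'" "F' \<subseteq> carrier_vec ?p \<times> UNIV" using F by (auto simp: F'_def)
  from sp.small_penalty_exact[OF this] obtain \<delta> where "\<delta> > 0" and
    \<delta>: "\<forall>\<rho> S C x r0. 0 \<le> \<rho> \<longrightarrow> \<rho> < \<delta> \<longrightarrow> info S = D \<longrightarrow> C \<subseteq> F' \<longrightarrow> C \<noteq> {} \<longrightarrow>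
      r0 \<in> carrier_vec ?p \<longrightarrow> (\<forall>i<?p. \<bar>vec_index (post S x - r0) i\<bar> \<le> 2 * L) \<longrightarrow>
      x \<in> feasible ?n S \<longrightarrow> (\<forall>x'\<in>feasible ?n S. reg_obj (Q t) \<rho> r0 C S x \<le> reg_obj (Q t) \<rho> r0 C S x') \<longrightarrow>
      (\<forall>x'\<in>feasible ?n S. ereal (cost S x) + cut_max C (post S x) \<le>
          ereal (cost S x') + cut_max C (post S x'))"
    by (elim exE conjE)
  show ?thesis
  proof (rule exI[of _ \<delta>], intro conjI allI impI, fact)
    fix h it assume val: "valid (it # h)" and "h \<noteq> []" and small: "\<rho> (length h) < \<delta>"
    then obtain it0 h0 where h: "h = it0 # h0" by (cases h) auto
    define S where "S = forward_state pr sel h v t"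
    define x where "x = forward_dec sel h v t"
    define r0 where "r0 = trial_point pr it0 t"
    have fok: "forward_ok pr Q \<rho> sel h it" "forward_ok pr Q \<rho> sel h0 it0" and vh: "valid h"
      and sc: "scen it0 \<in> scenarios pr" using val h by auto
    have S: "info S = D" by (simp add: S_def D_def forward_state_def info_state_along)
    have x: "x \<in> feasible ?n S" using forward_feasible[OF fok(1) v] t by (simp add: x_def S_def)
    have post_x: "post S x = forward_post h v t" by (simp add: S_def x_def forward_post_eq)
    have post: "post S y \<in> carrier_vec ?p" for y using D S by (auto simp: post_def intro!: carrier_vecI)
    have r0: "r0 \<in> carrier_vec ?p" using trial_point_carrier[OF sc] t by (simp add: r0_def)
    have V: "Vbar pr h t (post S y) = cut_max (cut_set pr h t) (post S y)" for y
      using Vbar_eq_cut_max[OF vh t post] .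
    have C: "cut_set pr h t \<subseteq> F'" "cut_set pr h t \<noteq> {}"
      using F(2)[OF vh] cut_set_carrier[of h t] by (auto simp: F'_def h cut_set_Cons)
    have obj: "forward_obj pr Q \<rho> h t S y = reg_obj (Q t) (\<rho> (length h)) r0 (cut_set pr h t) S y" for y
      using t V by (simp add: forward_obj_def reg_obj_def r0_def h)
    have bnd: "\<forall>i<?p. \<bar>vec_index (post S x - r0) i\<bar> \<le> 2 * L"
    proof (intro allI impI)
      fix i assume i: "i < ?p"
      have "\<bar>vec_index (post S x) i\<bar> \<le> L"
        using L(2)[OF v forward_feasible_upto[OF fok(1) v] i] t unfolding post_x forward_post_def by simp
      moreover have "\<bar>vec_index r0 i\<bar> \<le> L"
        using L(2)[OF sc forward_feasible_upto[OF fok(2) sc] i] t trial_point_eq[OF fok(2), of t]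
        unfolding r0_def forward_post_def by simp
      ultimately show "\<bar>vec_index (post S x - r0) i\<bar> \<le> 2 * L" using i r0 by simp
    qed
    have "forward_obj pr Q \<rho> h t S x \<le> forward_obj pr Q \<rho> h t S x'" if "x' \<in> feasible ?n S" for x'
      using fok(1) v t that unfolding forward_ok_def is_arg_min_def S_def x_def by (meson
          less_imp_le not_less)
    then have min: "\<forall>x'\<in>feasible ?n S. reg_obj (Q t) (\<rho> (length h)) r0 (cut_set pr h t) S x
        \<le> reg_obj (Q t) (\<rho> (length h)) r0 (cut_set pr h t) S x'" unfolding obj by blast
    have "0 \<le> \<rho> (length h)" using penalty_nonneg by blast
    then have "\<forall>x'\<in>feasible ?n S. ereal (cost S x) + cut_max (cut_set pr h t) (post S x)
        \<le> ereal (cost S x') + cut_max (cut_set pr h t) (post S x')"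
      by (rule \<delta>[THEN spec, THEN spec, THEN spec, THEN spec, THEN spec, THEN mp, THEN mp, THEN mp,
          THEN mp, THEN mp,
            THEN mp, THEN mp, THEN mp, THEN mp, OF _ small S C r0 bnd x min])
    then have "ereal (cost S x) + Vbar pr h t (post S x) \<le> stage_value pr t (Vbar pr h t) S"
      unfolding stage_value_def V by (intro INF_greatest) simp
    moreover have "stage_value pr t (Vbar pr h t) S \<le> ereal (cost S x) + Vbar pr h t (post S x)"
      unfolding stage_value_def using x by (rule INF_lower)
    ultimately show "stage_value pr t (Vbar pr h t) (forward_state pr sel h v t) =
      ereal (cost (forward_state pr sel h v t) (forward_dec sel h v t)) + Vbar pr h t (forward_post
          h v t)"
      unfolding S_def[symmetric] x_def[symmetric] post_x[symmetric] by (rule antisym[rotated])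
  qed
qed

lemma forward_exact:
  "\<exists>\<delta>>0. \<forall>v\<in>scenarios pr. \<forall>t<T. \<forall>h it. valid (it # h) \<longrightarrow> h \<noteq> [] \<longrightarrow> \<rho> (length h) < \<delta> \<longrightarrow>
    stage_value pr t (Vbar pr h t) (forward_state pr sel h v t) =
      ereal (cost (forward_state pr sel h v t) (forward_dec sel h v t)) + Vbar pr h t (forward_post
          h v t)"
proof -
  have "\<exists>\<delta>>0. \<forall>z\<in>scenarios pr \<times> {..<T}. \<forall>h it. valid (it # h) \<longrightarrow> h \<noteq> [] \<longrightarrow> \<rho> (length h) < \<delta> \<longrightarrow>
    stage_value pr (snd z) (Vbar pr h (snd z)) (forward_state pr sel h (fst z) (snd z)) =
      ereal (cost (forward_state pr sel h (fst z) (snd z)) (forward_dec sel h (fst z) (snd z))) +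
      Vbar pr h (snd z) (forward_post h (fst z) (snd z))"
  proof (rule finite_uniform_threshold)
    show "finite (scenarios pr \<times> {..<T})" by (simp add: finite_scenarios)
    show "\<exists>\<delta>>0. \<forall>h it. valid (it # h) \<longrightarrow> h \<noteq> [] \<longrightarrow> \<rho> (length h) < \<delta> \<longrightarrow>
      stage_value pr (snd z) (Vbar pr h (snd z)) (forward_state pr sel h (fst z) (snd z)) =
        ereal (cost (forward_state pr sel h (fst z) (snd z)) (forward_dec sel h (fst z) (snd z))) +
        Vbar pr h (snd z) (forward_post h (fst z) (snd z))" if "z \<in> scenarios pr \<times> {..<T}" for z
      by (rule forward_exact_at) (use that in auto)
  qed (meson less_le_trans)
  then show ?thesis by (elim exE conjE) (rule exI, rule conjI, assumption, force simp del:
      valid_history.simps)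
qed

section \<open>From tightness to optimality\<close>

text \<open>By stagewise independence the outcome \<open>a\<close> keeps its positive probability
  when conditioned on the past of \<open>v\<close>, so some scenario has this past and this
  continuation. The expectation at a visited state thus averages over states that are visited as
  well.\<close>

lemma scenario_branch:
  assumes v: "v \<in> scenarios pr" and t: "t < T" and a: "a \<in> outcomes pr (Suc t)" and pos:
      "0 < stage_prob pr (Suc t) a"
  obtains w where "w \<in> scenarios pr" "restrict w {1..t} = restrict v {1..t}" "w (Suc t) = a"
proof -
  have "v \<in> set_pmf (law pr)" using pos_prob v by (metis less_irrefl pmf_eq_0_set_pmf)
  then have "cond_prob (measure_pmf (law pr)) (\<lambda>w. w (Suc t) = a)
      (\<lambda>w. restrict w {1..t} = restrict v {1..t}) > 0"
    using indep t a pos unfolding stagewise_independent_def by simp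
  then have "measure_pmf.prob (law pr) {w. w (Suc t) = a \<and> restrict w {1..t} = restrict v {1..t}} \<noteq> 0"
    by (auto simp: cond_prob_def)
  then have "set_pmf (law pr) \<inter> {w. w (Suc t) = a \<and> restrict w {1..t} = restrict v {1..t}} \<noteq> {}"
    by (simp add: measure_pmf_zero_iff)
  moreover have "set_pmf (law pr) \<subseteq> scenarios pr" using wf by (simp add: wf_mslp_def)
  ultimately show ?thesis using that by blast
qed

text \<open>Selections see only the scenario up to the current time, so a common past means a common
  resource state.\<close>

lemma forward_state_branch:
  assumes w: "restrict w {1..t} = restrict v {1..t}" "w (Suc t) = a"
  shows "forward_state pr sel h w (Suc t) = Pre (forward_post h v t) (data pr (Suc t) a)"
proof -
  have "w s = v s" if "s \<in> {1..t}" for s using fun_cong[OF w(1), of s] that by simp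
  then have "data_along pr w t = data_along pr v t" by (simp add: data_along_def)
  moreover have "forward_dec sel h w t = forward_dec sel h v t" by (simp only: forward_dec_def w(1))
  ultimately show ?thesis using w(2) by (simp add: forward_state_def state_along_def forward_post_def)
qed

text \<open>One inequality is enough: the comparison in the other direction is made with
  \<open>Vstar\<close>, through \<open>Vbar_le_Vstar\<close>.\<close>

definition tight :: "'w iteration list \<Rightarrow> bool" where
  "tight h \<longleftrightarrow> (\<forall>v\<in>scenarios pr. \<forall>t<T.
     exp_value pr (Suc t) (Vbar pr h (Suc t)) (forward_post h v t) \<le> Vbar pr h t (forward_post h v t))"

text \<open>At a visited resource state the induction hypothesis along all branches turns the
  expected value into \<open>Vstar\<close>, and tightness carries this over to \<open>Vbar\<close>.
  Exactness makes the forward decision optimal for \<open>Vbar\<close>, so the lower approximation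
  attains the optimal value already at this one point.\<close>

lemma tight_imp_optimal:
  assumes val: "valid (it # h)" and tight: "tight h"
    and exact: "\<And>v t. v \<in> scenarios pr \<Longrightarrow> t < T \<Longrightarrow> stage_value pr t (Vbar pr h t) (forward_state pr
        sel h v t) =
      ereal (cost (forward_state pr sel h v t) (forward_dec sel h v t)) + Vbar pr h t (forward_post
          h v t)"
    and "t \<le> T" "v \<in> scenarios pr"
  shows "stage_value pr t (Vbar pr h t) (forward_state pr sel h v t) =
      stage_value pr t (Vstar pr t) (forward_state pr sel h v t)"
  using assms(4,5)
proof (induction arbitrary: v rule: inc_induct)
  case base
  then show ?case by (simp add: Vbar_horizon)
next
  case (step t)
  let ?S = "forward_state pr sel h v t" and ?x = "forward_dec sel h v t" and ?R = "forward_post h v t"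
  have "exp_value pr (Suc t) (Vbar pr h (Suc t)) ?R = exp_value pr (Suc t) (Vstar pr (Suc t)) ?R"
    unfolding exp_value_def
  proof (rule sum.cong[OF refl])
    fix a assume a: "a \<in> outcomes pr (Suc t)"
    show "ereal (stage_prob pr (Suc t) a) * stage_value pr (Suc t) (Vbar pr h (Suc t)) (Pre ?R (data
        pr (Suc t) a)) =
      ereal (stage_prob pr (Suc t) a) * stage_value pr (Suc t) (Vstar pr (Suc t)) (Pre ?R (data pr
          (Suc t) a))"
    \<comment> \<open>An outcome of probability zero need not continue any scenario, but it
      contributes nothing to either side.\<close>
    proof (cases "stage_prob pr (Suc t) a = 0")
      case False
      then have "0 < stage_prob pr (Suc t) a" using stage_prob_nonneg[of pr "Suc t" a] by simp
      then obtain w where w: "w \<in> scenarios pr" "restrict w {1..t} = restrict v {1..t}" "w (Suc t) = a"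
        using scenario_branch[OF step.prems step.hyps(2) a] by blast
      then show ?thesis using step.IH[OF w(1)] forward_state_branch[OF w(2,3), of h] by simp
    qed (simp flip: zero_ereal_def)
  qed
  then have "Vstar pr t ?R = exp_value pr (Suc t) (Vbar pr h (Suc t)) ?R"
    using step.hyps by (simp add: Vstar.simps[of pr t])
  then have R: "Vstar pr t ?R \<le> Vbar pr h t ?R" using tight step.prems step.hyps(2) by (simp add:
      tight_def)
  have fok: "forward_ok pr Q \<rho> sel h it" and vh: "valid h" using val by auto
  have "stage_value pr t (Vstar pr t) ?S \<le> ereal (cost ?S ?x) + Vstar pr t (post ?S ?x)"
    unfolding stage_value_def using forward_feasible[OF fok step.prems] step.hyps by (intro
        INF_lower) simp
  also have "\<dots> \<le> ereal (cost ?S ?x) + Vbar pr h t ?R"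
    unfolding forward_post_eq using R by (rule add_left_mono)
  also have "\<dots> = stage_value pr t (Vbar pr h t) ?S" using exact step by simp
  finally have "stage_value pr t (Vstar pr t) ?S \<le> stage_value pr t (Vbar pr h t) ?S" .
  moreover have "stage_value pr t (Vbar pr h t) ?S \<le> stage_value pr t (Vstar pr t) ?S"
  proof (rule stage_value_mono)
    show "wf_stage pr t (info ?S)"
      using wf_data_along[OF step.prems] step.hyps by (simp add: forward_state_def info_state_along)
    show "Vbar pr h t R \<le> Vstar pr t R" if "R \<in> carrier_vec (rdim pr (Suc t))" for R
      using Vbar_le_Vstar[OF vh _ that] step.hyps by simp
  qed
  ultimately show ?case by (rule antisym[rotated])
qed

section \<open>Counting cuts and sampling violated scenarios\<close>

text \<open>A potential: bounded over valid histories, never decreasing, and strictly larger after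
  each sampled violation.\<close>

definition cut_count :: "'w iteration list \<Rightarrow> nat" where
  "cut_count h = (\<Sum>t<T. card (cut_set pr h t))"

lemma cut_count_bounded: "\<exists>N. \<forall>h. valid h \<longrightarrow> cut_count h \<le> N"
proof -
  obtain F where F: "\<And>t. t < T \<Longrightarrow> finite (F t)" "\<And>t h. t < T \<Longrightarrow> valid h \<Longrightarrow> cut_set pr h t \<subseteq> F t"
    using finitely_many_cuts by (metis less_imp_le)
  have "cut_count h \<le> (\<Sum>t<T. card (F t))" if "valid h" for h
    unfolding cut_count_def using F that by (intro sum_mono card_mono) auto
  then show ?thesis by blast
qed

lemma cut_count_mono: "cut_count h \<le> cut_count (it # h)"
  unfolding cut_count_def by (intro sum_mono card_mono) (auto simp: cut_set_Cons finite_cut_set)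

text \<open>Chosen from the history alone, hence independent of the next sampled scenario.\<close>

definition violated_scenario :: "'w iteration list \<Rightarrow> (nat \<Rightarrow> 'w)" where
  "violated_scenario h = (SOME v. v \<in> scenarios pr \<and> (\<exists>t<T.
     \<not> exp_value pr (Suc t) (Vbar pr h (Suc t)) (forward_post h v t) \<le>
         Vbar pr h t (forward_post h v t)))"

lemma violated_scenario:
  assumes "\<not> tight h"
  shows "violated_scenario h \<in> scenarios pr"
    "\<exists>t<T. \<not> exp_value pr (Suc t) (Vbar pr h (Suc t)) (forward_post h (violated_scenario h) t)
       \<le> Vbar pr h t (forward_post h (violated_scenario h) t)"
proof -
  have "\<exists>v. v \<in> scenarios pr \<and> (\<exists>t<T.
     \<not> exp_value pr (Suc t) (Vbar pr h (Suc t)) (forward_post h v t) \<le> Vbar pr h t (forward_post h v t))"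
    using assms unfolding tight_def by blast
  from someI_ex[OF this] show "violated_scenario h \<in> scenarios pr"
    "\<exists>t<T. \<not> exp_value pr (Suc t) (Vbar pr h (Suc t)) (forward_post h (violated_scenario h) t)
       \<le> Vbar pr h t (forward_post h (violated_scenario h) t)"
    unfolding violated_scenario_def by blast+
qed

text \<open>If no cut were added at the violated time, the approximation there would be unchanged,
  although after the backward pass it dominates the new expected value at the trial point. The
  update one stage later can only have raised that expected value, so the old one would be dominated
  too.\<close>

lemma cut_count_increases:
  assumes val: "valid (it # h)" and "\<not> tight h" and scen: "scen it = violated_scenario h"
  shows "cut_count h < cut_count (it # h)"
proof -
  obtain t where t: "t < T" and viol: "\<not> exp_value pr (Suc t) (Vbar pr h (Suc t)) (forward_post h
      (scen it) t)
       \<le> Vbar pr h t (forward_post h (scen it) t)"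
    using violated_scenario(2)[OF assms(2)] scen by auto
  let ?R = "forward_post h (scen it) t"
  have vh: "valid h" and sc: "scen it \<in> scenarios pr" and fok: "forward_ok pr Q \<rho> sel h it"
      using val by auto
  have tp: "trial_point pr it t = ?R" using trial_point_eq[OF fok] t by simp
  have Rc: "?R \<in> carrier_vec (rdim pr (Suc t))" using forward_post_carrier[OF sc] t by simp
  have "cut_set pr h t \<noteq> cut_set pr (it # h) t"
  proof
    assume eq: "cut_set pr h t = cut_set pr (it # h) t"
    have "exp_value pr (Suc t) (Vbar pr h (Suc t)) ?R \<le> exp_value pr (Suc t) (Vbar pr (it # h) (Suc
        t)) ?R"
      by (rule exp_value_mono) (use t wf_data Vbar_mono_history[of "Suc t" pr h _ it] in auto)
    also have "\<dots> \<le> Vbar pr (it # h) t ?R" using exp_value_le_Vbar_trial_point[OF val t] tp by simp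
    also have "\<dots> = Vbar pr h t ?R" using Vbar_eq_cut_max[OF val t Rc] Vbar_eq_cut_max[OF vh t Rc] eq
        by simp
    finally show False using viol by blast
  qed
  then have "cut_set pr h t \<subset> cut_set pr (it # h) t" by (auto simp: cut_set_Cons)
  then have "card (cut_set pr h t) < card (cut_set pr (it # h) t)"
      by (rule psubset_card_mono[OF finite_cut_set])
  then show ?thesis unfolding cut_count_def using t
    by (intro sum_strict_mono_ex1) (auto simp: cut_set_Cons finite_cut_set intro!: card_mono)
qed


text \<open>Whatever the past, a violated scenario is sampled with probability bounded below, and each
  such event creates a cut.  As the number of cuts is bounded, Borel--Cantelli applies.\<close>

lemma eventually_tight:
  fixes M :: "'m measure" and It :: "nat \<Rightarrow> 'm \<Rightarrow> 'w iteration"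
  assumes M: "prob_space M" and run: "qrm_run pr Q \<rho> sel M It"
    and valid: "AE m in M. \<forall>k. valid (history It k m)"
  shows "AE m in M. eventually (\<lambda>k. tight (history It k m)) sequentially"
proof -
  interpret prob_space M by fact
  have hist [measurable]: "history It k \<in> measurable M (count_space UNIV)"
    and scen [measurable]: "(\<lambda>m. scen (It k m)) \<in> measurable M (count_space UNIV)"
    and distr: "distr M (count_space UNIV) (\<lambda>m. scen (It k m)) = measure_pmf (law pr)"
    and ind: "indep_set {history It k -` X \<inter> space M | X. X \<in> UNIV} {(\<lambda>m. scen (It k m)) -` Y \<inter>
        space M | Y. Y \<in> UNIV}" for k
    using run by (auto simp: qrm_run_def)
  obtain N where N: "\<And>h. valid h \<Longrightarrow> cut_count h \<le> N" using cut_count_bounded by blast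
  have ne: "scenarios pr \<noteq> {}" using wf set_pmf_not_empty[of "law pr"] by (auto simp: wf_mslp_def)
  \<comment> \<open>A lower bound, whatever the past, for the chance of sampling the violated
    scenario; it is positive because there are finitely many scenarios.\<close>
  define p where "p = Min (pmf (law pr) ` scenarios pr)"
  have p_pos: "0 < p" unfolding p_def using finite_scenarios ne pos_prob by (subst Min_gr_iff) auto
  have p_le: "p \<le> pmf (law pr) v" if "v \<in> scenarios pr" for v
    unfolding p_def using finite_scenarios that by (intro Min_le) auto
  \<comment> \<open>Splitting by \<open>v\<close> replaces the random witness by fixed events, to
    which independence of history and sample applies.\<close>
  define H where "H k v = history It k -` {h. \<not> tight h \<and> violated_scenario h = v} \<inter> space M" for k v
  define Y where "Y k v = (\<lambda>m. scen (It k m)) -` {v} \<inter> space M" for k v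
  define E where "E k = history It k -` {h. \<not> tight h} \<inter> space M" for k
  define G where "G k = (\<Union>v\<in>scenarios pr. H k v \<inter> Y k v)" for k
  have H [measurable]: "H k v \<in> events" for k v unfolding H_def by (rule measurable_sets[OF hist]) simp
  have Y [measurable]: "Y k v \<in> events" for k v unfolding Y_def by (rule measurable_sets[OF scen]) simp
  have E [measurable]: "E k \<in> events" for k unfolding E_def by (rule measurable_sets[OF hist]) simp
  have G [measurable]: "G k \<in> events" for k unfolding G_def using finite_scenarios by (intro
      sets.finite_UN) auto
  have probY: "prob (Y k v) = pmf (law pr) v" for k v
  proof -
    have "pmf (law pr) v = measure (distr M (count_space UNIV) (\<lambda>m. scen (It k m))) {v}"
      by (simp add: distr pmf.rep_eq)
    also have "\<dots> = prob (Y k v)" unfolding Y_def by (subst measure_distr[OF scen]) auto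
    finally show ?thesis by simp
  qed
  have E_eq: "E k = (\<Union>v\<in>scenarios pr. H k v)" for k
    unfolding E_def H_def using violated_scenario(1) by auto
  have probE: "prob (E k) = (\<Sum>v\<in>scenarios pr. prob (H k v))" for k
    unfolding E_eq
  proof (rule finite_measure_finite_Union[OF finite_scenarios])
    show "disjoint_family_on (H k) (scenarios pr)" by (auto simp: disjoint_family_on_def H_def)
  qed (use H in auto)
  have probG: "prob (G k) = (\<Sum>v\<in>scenarios pr. prob (H k v \<inter> Y k v))" for k
    unfolding G_def
  proof (rule finite_measure_finite_Union[OF finite_scenarios])
    show "disjoint_family_on (\<lambda>v. H k v \<inter> Y k v) (scenarios pr)" by (auto simp:
        disjoint_family_on_def Y_def)
  qed (use H Y in auto)
  have EG: "p * prob (E k) \<le> prob (G k)" for k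
  proof -
    have "p * prob (H k v) \<le> prob (H k v \<inter> Y k v)" if v: "v \<in> scenarios pr" for v
    proof -
      have "prob (H k v \<inter> Y k v) = prob (H k v) * prob (Y k v)"
      proof (rule indep_setD[OF ind[of k]])
        show "H k v \<in> {history It k -` X \<inter> space M | X. X \<in> UNIV}"
          unfolding H_def by (rule CollectI, rule exI, rule conjI[OF refl UNIV_I])
        show "Y k v \<in> {(\<lambda>m. scen (It k m)) -` Y \<inter> space M | Y. Y \<in> UNIV}"
          unfolding Y_def by (rule CollectI, rule exI, rule conjI[OF refl UNIV_I])
      qed
      then show ?thesis using mult_right_mono[OF p_le[OF v], of "prob (H k v)"] probY[of k v]
        by (simp add: mult.commute)
    qed
    then show ?thesis unfolding probE probG sum_distrib_left by (rule sum_mono)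
  qed
  \<comment> \<open>Along almost every path each occurrence of \<open>G k\<close> adds at least one
    cut, so at most \<open>N\<close> of them occur.\<close>
  have sumG: "(\<Sum>k<n. prob (G k)) \<le> real N" for n
  proof -
    have "AE m in M. (\<Sum>k<n. indicator (G k) m) \<le> real N"
      using valid
    proof eventually_elim
      case (elim m)
      have "(\<Sum>k<n. indicator (G k) m) \<le> real (cut_count (history It n m))"
      proof (induction n)
        case (Suc n)
        have val: "valid (It n m # history It n m)" using elim[rule_format, of "Suc n"] by simp
        have "indicator (G n) m + real (cut_count (history It n m)) \<le>
            real (cut_count (It n m # history It n m))"
        proof (cases "m \<in> G n")
          case True
          then have "\<not> tight (history It n m)" "scen (It n m) = violated_scenario (history It n m)"
            by (auto simp: G_def H_def Y_def)
          then show ?thesis using cut_count_increases[OF val] True by simp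
        next
          case False
          then show ?thesis using cut_count_mono by simp
        qed
        then show ?case using Suc by simp
      qed simp
      also have "\<dots> \<le> real N" using N elim by simp
      finally show ?case .
    qed
    moreover have int: "integrable M (indicator (G k) :: 'm \<Rightarrow> real)" for k
      using G by (simp add: integrable_real_indicator emeasure_eq_measure)
    ultimately have "(\<integral>m. (\<Sum>k<n. indicator (G k) m) \<partial>M) \<le> (\<integral>m. real N \<partial>M)"
      by (intro integral_mono_AE Bochner_Integration.integrable_sum) simp_all
    moreover have "(\<integral>m. (\<Sum>k<n. indicator (G k) m) \<partial>M) = (\<Sum>k<n. prob (G k))"
      using int by (subst Bochner_Integration.integral_sum) simp_all
    ultimately show ?thesis by (simp add: prob_space)
  qed
  have "summable (\<lambda>k. prob (E k))"
  proof (rule summableI_nonneg_bounded)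
    fix n
    have "p * (\<Sum>k<n. prob (E k)) \<le> (\<Sum>k<n. prob (G k))"
      unfolding sum_distrib_left by (intro sum_mono EG)
    then have "p * (\<Sum>k<n. prob (E k)) \<le> real N" using sumG[of n] by simp
    then show "(\<Sum>k<n. prob (E k)) \<le> real N / p" using p_pos by (simp add: pos_le_divide_eq mult.commute)
  qed simp
  then have "AE m in M. eventually (\<lambda>k. m \<in> space M - E k) sequentially"
    by (intro borel_cantelli_AE1) (auto simp: emeasure_eq_measure)
  then show ?thesis
  proof eventually_elim
    case (elim m)
    then show ?case by eventually_elim (auto simp: E_def)
  qed
qed

end

theorem theorem6:
  fixes pr :: "'w mslp"
    and Q :: "nat \<Rightarrow> rmat"
    and \<rho> :: "nat \<Rightarrow> real"
    and sel :: "'w rule"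
    and M :: "'m measure"
    and It :: "nat \<Rightarrow> 'm \<Rightarrow> 'w iteration"
  assumes "wf_mslp pr"
    and "stagewise_independent pr"
    and "relatively_complete_recourse pr"
    and "\<forall>t\<le>horizon pr. psd_mat (rdim pr (Suc t)) (Q t)"
    and "prob_space M"
    and "qrm_run pr Q \<rho> sel M It"
    and "AE m in M. \<forall>k. dual_basic_used pr (history It k m) (It k m)"
    and "\<forall>v\<in>scenarios pr. 0 < pmf (law pr) v"
    and "\<forall>k. 0 \<le> \<rho> k"
    and "\<rho> \<longlonglongrightarrow> 0"
    and "bounded_feasible_sets pr"
  shows "AE m in M. \<exists>k0. \<forall>k\<ge>k0. \<forall>v\<in>scenarios pr. \<forall>t\<le>horizon pr.
           (let h = history It (Suc k) m; S = forward_state pr sel h v t in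
              stage_value pr t (Vbar pr h t) S = stage_value pr t (Vstar pr t) S)"
proof -
  interpret qrm pr Q \<rho> sel by unfold_locales (use assms in auto)
  have "AE m in M. \<forall>k. scen (It k m) \<in> scenarios pr"
  proof (subst AE_all_countable, rule allI)
    fix k
    have scen: "(\<lambda>m. scen (It k m)) \<in> measurable M (count_space UNIV)"
      and distr: "distr M (count_space UNIV) (\<lambda>m. scen (It k m)) = measure_pmf (law pr)"
      using assms(6) unfolding qrm_run_def by blast+
    have "AE v in distr M (count_space UNIV) (\<lambda>m. scen (It k m)). v \<in> scenarios pr"
      unfolding distr using assms(1) by (auto simp: AE_measure_pmf_iff wf_mslp_def)
    then show "AE m in M. scen (It k m) \<in> scenarios pr" by (rule AE_distrD[OF scen])
  qed
  moreover have "AE m in M. \<forall>k. forward_ok pr Q \<rho> sel (history It k m) (It k m) \<and>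
      backward_ok pr (history It k m) (It k m)"
    using assms(6) by (simp add: qrm_run_def)
  ultimately have val: "AE m in M. \<forall>k. valid (history It k m)"
    using assms(7)
  proof eventually_elim
    case (elim m)
    show ?case
    proof
      show "valid (history It k m)" for k by (induction k) (use elim in auto)
    qed
  qed
  obtain \<delta> where "\<delta> > 0" and exact: "\<forall>v\<in>scenarios pr. \<forall>t<T. \<forall>h it. valid (it # h) \<longrightarrow> h \<noteq> [] \<longrightarrow>
      \<rho> (length h) < \<delta> \<longrightarrow>
    stage_value pr t (Vbar pr h t) (forward_state pr sel h v t) =
      ereal (cost (forward_state pr sel h v t) (forward_dec sel h v t)) + Vbar pr h t (forward_post
          h v t)"
    using forward_exact by (elim exE conjE)
  have small: "eventually (\<lambda>k. \<rho> k < \<delta>) sequentially" using order_tendstoD(2)[OF assms(10) \<open>\<delta> > 0\<close>] .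
  have len: "length (history It k m) = k" for k m by (induction k) simp_all
  show ?thesis
    using val eventually_tight[OF assms(5,6) val]
  proof eventually_elim
    case (elim m)
    from eventually_conj[OF small elim(2)] obtain k0
      where k0: "\<And>k. k \<ge> k0 \<Longrightarrow> \<rho> k < \<delta> \<and> tight (history It k m)"
      by (auto simp: eventually_sequentially)
    show ?case
    proof (intro exI[of _ k0] allI impI ballI, unfold Let_def)
      fix k v t assume k: "k \<ge> k0" and v: "v \<in> scenarios pr" and t: "t \<le> horizon pr"
      define h where "h = history It (Suc k) m"
      \<comment> \<open>The history of length \<open>k + 1\<close> carries the approximation with
        upper index \<open>k\<close>, and the next forward pass has penalty index
        \<open>k + 1\<close>. Its selections are certified by the iteration after it, so validity is
        taken one step further.\<close>
      have "valid (history It (Suc (Suc k)) m)" using elim(1) by blast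
      then have vh: "valid (It (Suc k) m # h)" by (simp only: h_def history.simps(2))
      have "\<rho> (length h) < \<delta>" "tight h" using k0[of "Suc k"] k len[of "Suc k" m] by (simp_all add:
          h_def del: history.simps)
      moreover have "h \<noteq> []" by (simp add: h_def)
      ultimately show "stage_value pr t (Vbar pr (history It (Suc k) m) t) (forward_state pr sel
          (history It (Suc k) m) v t) =
          stage_value pr t (Vstar pr t) (forward_state pr sel (history It (Suc k) m) v t)"
        unfolding h_def[symmetric] using tight_imp_optimal[OF vh _ _ t v] exact vh by blast
    qed
  qed
qed

end
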